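(* Let $H$ be a real separable Hilbert space and let $R:H\to H$ be a bounded linear self-adjoint operator. For any $n\in\mathbb{N}=\{1,2,\ldots\}$ it holds $\mathrm{BUC}^n_{H_R}(H)=\mathrm{BUC}^n_{R}(H)$. Moreover, if $\varphi\in \mathrm{BUC}^n_{R}(H)$ and $x\in H$, then $$\nabla^{n}_{H_R}\varphi(x)= T_{n-1}\left(\nabla^{n}_{R}\varphi(x)\right),$$ that is, $\nabla_{H_R}\varphi(x)=R\nabla_R\varphi(x)$ if $n=1$, and $\nabla^n_{H_R}\varphi(x)(v_1,\ldots,v_{n-1})=R\,\nabla^n_R\varphi(x)(R^{-1}v_1,\ldots,R^{-1}v_{n-1})$ for all $v_1,\ldots,v_{n-1}\in H_R$ if $n\ge 2$.
   Context: Multilinear maps: for Banach spaces $K_1,K_2$ and $k\ge1$, $\mathcal{L}^{(k)}(K_1;K_2)$ is the space of continuous $k$-linear maps $K_1^k\to K_2$ with norm $\sup_{h_i\neq0}\|T(h_1,\ldots,h_k)\|_{K_2}/(\|h_1\|_{K_1}\cdots\|h_k\|_{K_1})$; $\mathcal{L}^{(k)}(K_1):=\mathcal{L}^{(k)}(K_1;K_1)$, $\mathcal{L}^{(0)}(K_1):=K_1$. $\mathrm{BUC}(K_1;K_2)$ is the space of bounded uniformly continuous functions; $\mathrm{BUC}(K_1):=\mathrm{BUC}(K_1;\mathbb{R})$. The space $H_R$: $H_R:=R(H)$, $R^{-1}:=(R_{|(\ker R)^\perp})^{-1}:H_R\to(\ker R)^\perp$ (pseudo-inverse), and $H_R$ is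 a separable Hilbert space with $\langle x,y\rangle_{H_R}:=\langle R^{-1}x,R^{-1}y\rangle_H$; it is continuously embedded in $H$. $H_R$-Fréchet differentiability: for a Banach space $Y$, $f:H\to Y$ is $H_R$-Fréchet differentiable at $x\in H$ if there is a (unique) $L_x\in\mathcal{L}(H_R;Y)$ with $\lim_{\|h\|_{H_R}\to0}\|f(x+h)-f(x)-L_xh\|_Y/\|h\|_{H_R}=0$; write $\mathcal{D}_{H_R}f(x):=L_x$. Higher orders are defined inductively ($f$ is twice $H_R$-Fréchet differentiable if it is $H_R$-Fréchet differentiable and $\mathcal{D}_{H_R}f:H\to\mathcal{L}(H_R;Y)$ is $H_R$-Fréchet differentiable, with $\mathcal{D}^2_{H_R}f(x)(h,k):=\mathcal{D}_{H_R}(\mathcal{D}_{H_R}f(x)h)k$, and so on), giving $\mathcal{D}^k_{H_R}f(x)\in\mathcal{L}^{(k)}(H_R;Y)$. For real-valued $f$, $\nabla^k_{H_R}f(x)\in\mathcal{L}^{(k-1)}(H_R)$ is the unique element with $\mathcal{D}^k_{H_R}f(x)(h_1,\ldots,h_k)=\langle\nabla^k_{H_R}f(x)(h_1,\ldots,h_{k-1}),h_k\rangle_{H_R}$ for all $h_i\in H_R$ (for $k=1$, $\nabla_{H_R}f(x)\in H_R$). $\mathrm{BUC}^k_{H_R}(H)$ is the space of $k$-times $H_R$-Fréchet differentiable $f\in\mathrm{BUC}(H)$ such that $\nabla^i_{H_R}f\in\mathrm{BUC}(H;\mathcal{L}^{(i-1)}(H_R))$ for $i=1,\ldots,k$. $R$-differentiability: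 $f:H\to\mathbb{R}$ is $R$-differentiable at $x\in H$ if there is $l_x\in H$ such that for all $v\in H$, $\lim_{s\to0}|\frac{f(x+sRv)-f(x)}{s}-\langle l_x,v\rangle_H|=0$; $\nabla_Rf(x):=l_x$. Inductively, for $k\ge1$, $f$ is $(k+1)$-times $R$-differentiable at $x$ if it is $k$-times $R$-differentiable and there is a unique $B_x\in\mathcal{L}^{(k)}(H)$ such that for all $v\in H$, $\frac{\nabla^k_Rf(x+sRv)-\nabla^k_Rf(x)}{s}\to B_x(\cdot,\ldots,\cdot,v)$ in $\mathcal{L}^{(k-1)}(H)$ as $s\to0$; $\nabla^{k+1}_Rf(x):=B_x$. $\mathrm{BUC}^k_R(H)$ is the space of $k$-times $R$-differentiable $f\in\mathrm{BUC}(H)$ with $\nabla^i_Rf\in\mathrm{BUC}(H;\mathcal{L}^{(i-1)}(H))$ for $i=1,\ldots,k$. The map $T_m$: for $m\ge1$, $T_m:\mathcal{L}^{(m)}((\ker R)^\perp)\to\mathcal{L}^{(m)}(H_R)$, $(T_mA)(v_1,\ldots,v_m):=RA(R^{-1}v_1,\ldots,R^{-1}v_m)$, and $T_0:(\ker R)^\perp\to H_R$, $T_0v:=Rv$. It is applied to $\nabla^n_R\varphi(x)$, which takes values in $(\ker R)^\perp$, restricted to arguments in $(\ker R)^\perp$. *)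

theory Defs
  imports "HOL-Analysis.Analysis" "HOL-Library.Function_Algebras"
begin

text \<open>
  Since \<^term>\<open>range R\<close> carries its own norm and depends on \<^term>\<open>R\<close>, normed spaces are
  given by a carrier subspace of an ambient real vector space together with a norm; the values
  of the norm outside the carrier are irrelevant.  Spaces of multilinear maps have function types
  as ambient spaces, which therefore need the pointwise vector space structure.
\<close>

instantiation "fun" :: (type, real_vector) real_vector
begin

definition scaleR_fun :: "real \<Rightarrow> ('a \<Rightarrow> 'b) \<Rightarrow> 'a \<Rightarrow> 'b"
  where "scaleR_fun c f = (\<lambda>x. c *\<^sub>R f x)"

instance
  by standard (auto simp: scaleR_fun_def fun_eq_iff scaleR_add_right scaleR_add_left)

end

record 'v nspace =
  carr :: "'v set"
  nrm :: "'v \<Rightarrow> real"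

definition whole :: "'v::real_normed_vector nspace"
  where "whole = \<lparr>carr = UNIV, nrm = norm\<rparr>"


subsection \<open>Continuous multilinear maps\<close>

definition tuples :: "'u nspace \<Rightarrow> nat \<Rightarrow> 'u list set"
  where "tuples K k = {hs. length hs = k \<and> set hs \<subseteq> carr K}"

definition multilinear_on ::
    "nat \<Rightarrow> 'u::real_vector nspace \<Rightarrow> ('u list \<Rightarrow> 'v::real_vector) \<Rightarrow> bool"
  where "multilinear_on k K T \<longleftrightarrow>
    (\<forall>hs \<in> tuples K k. \<forall>i<k. \<forall>a \<in> carr K. \<forall>b \<in> carr K. \<forall>c.
       T (hs[i := a + b]) = T (hs[i := a]) + T (hs[i := b]) \<and>
       T (hs[i := c *\<^sub>R a]) = c *\<^sub>R T (hs[i := a]))"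

definition multicontinuous_on ::
    "nat \<Rightarrow> 'u::real_vector nspace \<Rightarrow> 'v::real_vector nspace \<Rightarrow> ('u list \<Rightarrow> 'v) \<Rightarrow> bool"
  where "multicontinuous_on k K1 K2 T \<longleftrightarrow>
    (\<forall>hs \<in> tuples K1 k. \<forall>\<epsilon>>0. \<exists>\<delta>>0. \<forall>hs' \<in> tuples K1 k.
       (\<forall>i<k. nrm K1 (hs' ! i - hs ! i) < \<delta>) \<longrightarrow> nrm K2 (T hs' - T hs) < \<epsilon>)"

text \<open>
  A \<^term>\<open>k\<close>-linear map is a function on lists, normalised to be zero off the \<^term>\<open>k\<close>-tuples
  over the domain so that equality of such functions is equality of maps.  For
  \<^term>\<open>k = (0::nat)\<close> the map \<^term>\<open>T\<close> is identified with its only value \<^term>\<open>T []\<close>, which makes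
  the space of \<^term>\<open>0\<close>-linear maps an isometric copy of the codomain.  For \<^term>\<open>k = (1::nat)\<close>,
  \<^term>\<open>T [h]\<close> is the value at \<^term>\<open>h\<close> of a continuous linear map.
  The element \<^term>\<open>0::real\<close> in the supremum only matters when the domain is trivial.
\<close>

definition multilin ::
    "nat \<Rightarrow> 'u::real_vector nspace \<Rightarrow> 'v::real_vector nspace \<Rightarrow> ('u list \<Rightarrow> 'v) nspace"
  where "multilin k K1 K2 = \<lparr>
    carr = {T. (\<forall>hs \<in> tuples K1 k. T hs \<in> carr K2) \<and> (\<forall>hs. hs \<notin> tuples K1 k \<longrightarrow> T hs = 0) \<and>
               multilinear_on k K1 T \<and> multicontinuous_on k K1 K2 T},
    nrm = (\<lambda>T. Sup (insert 0
            {nrm K2 (T hs) / prod_list (map (nrm K1) hs) | hs. hs \<in> tuples K1 k \<and> 0 \<notin> set hs}))\<rparr>"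

definition BUC :: "'v::real_vector nspace \<Rightarrow> ('a::real_normed_vector \<Rightarrow> 'v) set"
  where "BUC Y = {f. (\<forall>x. f x \<in> carr Y) \<and> (\<exists>C. \<forall>x. nrm Y (f x) \<le> C) \<and>
    (\<forall>\<epsilon>>0. \<exists>\<delta>>0. \<forall>x y. dist x y < \<delta> \<longrightarrow> nrm Y (f x - f y) < \<epsilon>)}"


subsection \<open>The space $H_R$\<close>

definition ker :: "('a::real_inner \<Rightarrow> 'a) \<Rightarrow> 'a set"
  where "ker R = {x. R x = 0}"

definition pinv :: "('a::real_inner \<Rightarrow> 'a) \<Rightarrow> 'a \<Rightarrow> 'a"
  where "pinv R = inv_into ((ker R)\<^sup>\<bottom>) R"

definition inner_HR :: "('a::real_inner \<Rightarrow> 'a) \<Rightarrow> 'a \<Rightarrow> 'a \<Rightarrow> real"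
  where "inner_HR R x y = inner (pinv R x) (pinv R y)"

definition HR :: "('a::real_inner \<Rightarrow> 'a) \<Rightarrow> 'a nspace"
  where "HR R = \<lparr>carr = range R, nrm = (\<lambda>x. sqrt (inner_HR R x x))\<rparr>"

definition ker_perp :: "('a::real_inner \<Rightarrow> 'a) \<Rightarrow> 'a nspace"
  where "ker_perp R = \<lparr>carr = (ker R)\<^sup>\<bottom>, nrm = norm\<rparr>"


subsection \<open>Frechet differentiability along $H_R$\<close>

definition has_HR_derivative_at ::
    "('a::real_inner \<Rightarrow> 'a) \<Rightarrow> 'v::real_vector nspace \<Rightarrow> ('a \<Rightarrow> 'v) \<Rightarrow> 'a \<Rightarrow> ('a list \<Rightarrow> 'v) \<Rightarrow> bool"
  where "has_HR_derivative_at R Y f x L \<longleftrightarrow> L \<in> carr (multilin 1 (HR R) Y) \<and>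
    (\<forall>\<epsilon>>0. \<exists>\<delta>>0. \<forall>h \<in> carr (HR R). 0 < nrm (HR R) h \<and> nrm (HR R) h < \<delta> \<longrightarrow>
       nrm Y (f (x + h) - f x - L [h]) / nrm (HR R) h < \<epsilon>)"

definition HR_differentiable_at ::
    "('a::real_inner \<Rightarrow> 'a) \<Rightarrow> 'v::real_vector nspace \<Rightarrow> ('a \<Rightarrow> 'v) \<Rightarrow> 'a \<Rightarrow> bool"
  where "HR_differentiable_at R Y f x \<longleftrightarrow> (\<exists>!L. has_HR_derivative_at R Y f x L)"

definition HR_D ::
    "('a::real_inner \<Rightarrow> 'a) \<Rightarrow> 'v::real_vector nspace \<Rightarrow> ('a \<Rightarrow> 'v) \<Rightarrow> 'a \<Rightarrow> 'a list \<Rightarrow> 'v"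
  where "HR_D R Y f x = (THE L. has_HR_derivative_at R Y f x L)"

text \<open>
  The derivative of order \<^term>\<open>k\<close>, a \<^term>\<open>k\<close>-linear map; the last argument is the direction
  of the last differentiation.  Only \<^term>\<open>k \<ge> (1::nat)\<close> is meaningful.
\<close>

fun HR_Dk ::
    "('a::real_inner \<Rightarrow> 'a) \<Rightarrow> 'v::real_vector nspace \<Rightarrow> nat \<Rightarrow> ('a \<Rightarrow> 'v) \<Rightarrow> 'a \<Rightarrow> 'a list \<Rightarrow> 'v"
  where
    "HR_Dk R Y 0 f x = undefined"
  | "HR_Dk R Y (Suc 0) f x = HR_D R Y f x"
  | "HR_Dk R Y (Suc (Suc k)) f x =
       (\<lambda>hs. if hs \<in> tuples (HR R) (Suc (Suc k))
             then HR_D R Y (\<lambda>y. HR_Dk R Y (Suc k) f y (butlast hs)) x [last hs] else 0)"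

fun HR_times_differentiable ::
    "('a::real_inner \<Rightarrow> 'a) \<Rightarrow> 'v::real_vector nspace \<Rightarrow> nat \<Rightarrow> ('a \<Rightarrow> 'v) \<Rightarrow> bool"
  where
    "HR_times_differentiable R Y 0 f \<longleftrightarrow> True"
  | "HR_times_differentiable R Y (Suc 0) f \<longleftrightarrow> (\<forall>x. HR_differentiable_at R Y f x)"
  | "HR_times_differentiable R Y (Suc (Suc k)) f \<longleftrightarrow>
       HR_times_differentiable R Y (Suc k) f \<and>
       (\<forall>x. HR_differentiable_at R (multilin (Suc k) (HR R) Y) (HR_Dk R Y (Suc k) f) x)"

definition HR_nabla ::
    "('a::real_inner \<Rightarrow> 'a) \<Rightarrow> nat \<Rightarrow> ('a \<Rightarrow> real) \<Rightarrow> 'a \<Rightarrow> 'a list \<Rightarrow> 'a"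
  where "HR_nabla R k f x = (THE G. G \<in> carr (multilin (k - 1) (HR R) (HR R)) \<and>
    (\<forall>hs \<in> tuples (HR R) k.
       HR_Dk R whole k f x hs = inner_HR R (G (butlast hs)) (last hs)))"

definition BUC_HR :: "('a::real_inner \<Rightarrow> 'a) \<Rightarrow> nat \<Rightarrow> ('a \<Rightarrow> real) set"
  where "BUC_HR R n = {f \<in> BUC whole. HR_times_differentiable R whole n f \<and>
    (\<forall>i \<in> {1..n}. HR_nabla R i f \<in> BUC (multilin (i - 1) (HR R) (HR R)))}"


subsection \<open>$R$-differentiability\<close>

definition has_R_gradient_at :: "('a::real_inner \<Rightarrow> 'a) \<Rightarrow> ('a \<Rightarrow> real) \<Rightarrow> 'a \<Rightarrow> 'a \<Rightarrow> bool"
  where "has_R_gradient_at R f x l \<longleftrightarrow>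
    (\<forall>v. ((\<lambda>s. \<bar>(f (x + s *\<^sub>R R v) - f x) / s - inner l v\<bar>) \<longlongrightarrow> 0) (at 0))"

text \<open>The condition on \<^term>\<open>B\<close> relating the gradients of orders \<^term>\<open>k\<close> and \<^term>\<open>k + 1\<close>.\<close>

definition has_R_higher_gradient_at ::
    "('a::real_inner \<Rightarrow> 'a) \<Rightarrow> nat \<Rightarrow> ('a \<Rightarrow> 'a list \<Rightarrow> 'a) \<Rightarrow> 'a \<Rightarrow> ('a list \<Rightarrow> 'a) \<Rightarrow> bool"
  where "has_R_higher_gradient_at R k F x B \<longleftrightarrow> B \<in> carr (multilin k whole whole) \<and>
    (\<forall>v. ((\<lambda>s. nrm (multilin (k - 1) whole whole)
                ((F (x + s *\<^sub>R R v) - F x) /\<^sub>R s - (\<lambda>hs. B (hs @ [v])))) \<longlongrightarrow> 0) (at 0))"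

text \<open>
  The gradient of order \<^term>\<open>k\<close> is a \<^term>\<open>k - 1\<close>-linear map, with the identification of
  \<^term>\<open>0\<close>-linear maps with vectors made above.
\<close>

fun R_nabla :: "('a::real_inner \<Rightarrow> 'a) \<Rightarrow> nat \<Rightarrow> ('a \<Rightarrow> real) \<Rightarrow> 'a \<Rightarrow> 'a list \<Rightarrow> 'a"
  where
    "R_nabla R 0 f x = undefined"
  | "R_nabla R (Suc 0) f x = (\<lambda>hs. if hs = [] then THE l. has_R_gradient_at R f x l else 0)"
  | "R_nabla R (Suc (Suc k)) f x =
       (THE B. has_R_higher_gradient_at R (Suc k) (R_nabla R (Suc k) f) x B)"

fun R_times_differentiable_at :: "('a::real_inner \<Rightarrow> 'a) \<Rightarrow> nat \<Rightarrow> ('a \<Rightarrow> real) \<Rightarrow> 'a \<Rightarrow> bool"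
  where
    "R_times_differentiable_at R 0 f x \<longleftrightarrow> True"
  | "R_times_differentiable_at R (Suc 0) f x \<longleftrightarrow> (\<exists>l. has_R_gradient_at R f x l)"
  | "R_times_differentiable_at R (Suc (Suc k)) f x \<longleftrightarrow>
       (\<forall>y. R_times_differentiable_at R (Suc k) f y) \<and>
       (\<exists>!B. has_R_higher_gradient_at R (Suc k) (R_nabla R (Suc k) f) x B)"

definition BUC_R :: "('a::real_inner \<Rightarrow> 'a) \<Rightarrow> nat \<Rightarrow> ('a \<Rightarrow> real) set"
  where "BUC_R R n = {f \<in> BUC whole. (\<forall>x. R_times_differentiable_at R n f x) \<and>
    (\<forall>i \<in> {1..n}. R_nabla R i f \<in> BUC (multilin (i - 1) whole whole))}"


subsection \<open>The map $T_m$\<close>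

definition restrict_tuples :: "'u nspace \<Rightarrow> nat \<Rightarrow> ('u list \<Rightarrow> 'v::zero) \<Rightarrow> 'u list \<Rightarrow> 'v"
  where "restrict_tuples K m A = (\<lambda>hs. if hs \<in> tuples K m then A hs else 0)"

text \<open>For \<^term>\<open>m = (0::nat)\<close> this sends the vector \<^term>\<open>A []\<close> to \<^term>\<open>R (A [])\<close>.\<close>

definition T_map :: "('a::real_inner \<Rightarrow> 'a) \<Rightarrow> nat \<Rightarrow> ('a list \<Rightarrow> 'a) \<Rightarrow> 'a list \<Rightarrow> 'a"
  where "T_map R m A = restrict_tuples (HR R) m (\<lambda>vs. R (A (map (pinv R) vs)))"

end

theory Submission
  imports Defs
begin

text \<open>
  Membership of \<open>f\<close> in either space is equivalent to the existence of a jet of order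
  \<open>n\<close>: forms \<open>D k x\<close> for \<open>k \<le> n\<close>, where \<open>D k x\<close> is a bounded \<open>k\<close>-linear form on \<open>H\<close>
  that depends on \<open>x\<close> in a bounded and uniformly continuous way, \<open>D 0\<close> is \<open>f\<close>, and
  \<open>D (Suc k) x (vs @ [v])\<close> is the derivative at \<open>0\<close> of \<open>s \<mapsto> D k (x + s R v) vs\<close>.
  A jet only speaks of real functions of one real variable, so the mean value theorem applies to it
  directly.

  The map \<open>R\<close> is an isometry of \<open>(ker R)\<^sup>\<bottom>\<close> onto \<open>H\<^sub>R\<close> and a contraction of \<open>H\<close>
  onto \<open>H\<^sub>R\<close>.  Hence forms on \<open>H\<^sub>R\<close> and forms on \<open>H\<close> can be moved to each other by
  \<open>R\<close> and \<open>pinv R\<close> without increasing norms (\<open>pullback_multilin\<close>).  By Riesz, a form of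
  order \<open>m + 1\<close> on \<open>H\<^sub>R\<close> is the inner product of its last argument with an \<open>m\<close>-linear map,
  and this correspondence is isometric (\<open>represents_exists\<close>, \<open>represents_nrm\<close>), so that
  a gradient is bounded and uniformly continuous exactly when the derivative that it represents is.

  From Frechet derivatives along \<open>H\<^sub>R\<close> one gets a jet by restricting to lines
  (\<open>jet_of_BUC_HR\<close>).  Conversely, a directional derivative that is linear and uniformly continuous
  is a Frechet derivative, by the mean value theorem and the bound of \<open>\<parallel>h\<parallel>\<close> by a multiple of
  \<open>\<parallel>h\<parallel>\<close> in \<open>H\<^sub>R\<close> (\<open>jet_mean_value\<close>, \<open>jet_has_HR_derivative\<close>).

  For the \<open>R\<close>-gradients the two directions use different slots of the form.  The inner product
  with \<open>\<nabla>\<^sub>R f\<close> is the first differentiation, and further differentiations append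
  arguments; so \<open>D (Suc k) x (w # vs) = inner (\<nabla>\<^sub>R\<^sup>k\<^sup>+\<^sup>1 f x vs) w\<close>
  defines a jet (\<open>jet_of_BUC_R\<close>).  In the other direction the gradient has to be the representative
  in the last slot, as it is in \<open>H\<^sub>R\<close>.  That this representative is again obtained by
  differentiating the previous one needs an exchange of the last two differentiations, which is
  Schwarz's theorem (\<open>directional_Schwarz\<close>, \<open>jet_symmetric\<close>).

  Given a jet, \<open>\<nabla>\<^sub>R\<^sup>n f x\<close> represents \<open>D n x\<close> in the inner product of \<open>H\<close>, and
  \<open>\<nabla>\<^sub>H\<^sub>R\<^sup>n f x\<close> represents its transport to \<open>H\<^sub>R\<close> in that of
  \<open>H\<^sub>R\<close>.  As \<open>D n x\<close> vanishes when its last argument is in the kernel of \<open>R\<close>, the former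
  takes values in \<open>(ker R)\<^sup>\<bottom>\<close>, where \<open>R\<close> is isometric; comparing the two inner products
  gives the formula (\<open>HR_nabla_eq_R_nabla\<close>).
\<close>

section \<open>Normed carriers and bounded multilinear maps\<close>

definition normed_carrier :: "'v::real_vector nspace \<Rightarrow> bool"
  where "normed_carrier K \<longleftrightarrow> subspace (carr K) \<and>
    (\<forall>v \<in> carr K. 0 \<le> nrm K v \<and> (nrm K v = 0 \<longrightarrow> v = 0)) \<and>
    (\<forall>v \<in> carr K. \<forall>c. nrm K (c *\<^sub>R v) = \<bar>c\<bar> * nrm K v) \<and>
    (\<forall>u \<in> carr K. \<forall>v \<in> carr K. nrm K (u + v) \<le> nrm K u + nrm K v)"

lemma normed_carrierD:
  assumes "normed_carrier K"
  shows "0 \<in> carr K"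
    and "u \<in> carr K \<Longrightarrow> v \<in> carr K \<Longrightarrow> u + v \<in> carr K"
    and "u \<in> carr K \<Longrightarrow> v \<in> carr K \<Longrightarrow> u - v \<in> carr K"
    and "u \<in> carr K \<Longrightarrow> c *\<^sub>R u \<in> carr K"
    and "u \<in> carr K \<Longrightarrow> 0 \<le> nrm K u"
    and "u \<in> carr K \<Longrightarrow> nrm K u = 0 \<Longrightarrow> u = 0"
    and "u \<in> carr K \<Longrightarrow> nrm K (c *\<^sub>R u) = \<bar>c\<bar> * nrm K u"
    and "u \<in> carr K \<Longrightarrow> v \<in> carr K \<Longrightarrow> nrm K (u + v) \<le> nrm K u + nrm K v"
  using assms unfolding normed_carrier_def
  by (auto intro: subspace_0 subspace_add subspace_diff subspace_scale)

lemma normed_carrier_nrm_0: "normed_carrier K \<Longrightarrow> nrm K 0 = 0"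
  using normed_carrierD(7)[of K 0 0] normed_carrierD(1)[of K] by simp

lemma normed_carrier_whole: "normed_carrier (whole :: 'v::real_normed_vector nspace)"
  by (auto simp: normed_carrier_def whole_def norm_triangle_ineq subspace_UNIV)

lemma whole_simps [simp]: "carr whole = UNIV" "nrm whole = norm"
  by (auto simp: whole_def)

lemma tuples_whole [simp]: "hs \<in> tuples whole k \<longleftrightarrow> length hs = k"
  by (auto simp: tuples_def)

lemma tuples_append_Cons:
  "xs @ a # ys \<in> tuples K k \<longleftrightarrow>
    length xs + Suc (length ys) = k \<and> set xs \<subseteq> carr K \<and> a \<in> carr K \<and> set ys \<subseteq> carr K"
  by (auto simp: tuples_def)

lemma tuples_snoc:
  "hs @ [h] \<in> tuples K (Suc k) \<longleftrightarrow> hs \<in> tuples K k \<and> h \<in> carr K"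
  by (auto simp: tuples_def)

lemma tuples_Suc_snocE:
  assumes "hs \<in> tuples K (Suc k)"
  obtains gs h where "hs = gs @ [h]" "gs \<in> tuples K k" "h \<in> carr K"
  using assms by (cases hs rule: rev_cases) (auto simp: tuples_def)

lemma tuples_0: "hs \<in> tuples K 0 \<longleftrightarrow> hs = []"
  by (auto simp: tuples_def)

lemma tuples_1: "[h] \<in> tuples K (Suc 0) \<longleftrightarrow> h \<in> carr K"
  by (auto simp: tuples_def)

lemma prod_list_nrm_nonneg:
  "normed_carrier K \<Longrightarrow> set hs \<subseteq> carr K \<Longrightarrow> 0 \<le> prod_list (map (nrm K) hs)"
  by (induction hs) (auto intro!: mult_nonneg_nonneg dest: normed_carrierD(5))

lemma prod_list_norm_nonneg: "0 \<le> prod_list (map norm hs)"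
  by (induction hs) auto

text \<open>Splitting the tuple at the active slot avoids updates of lists in the inductions below.\<close>

text \<open>
  Naming the tuples before and after the active slot makes induction on the second of them possible.
\<close>

lemma multilinear_on_iff:
  "multilinear_on k K T \<longleftrightarrow>
    (\<forall>xs ys a b c. xs @ a # ys \<in> tuples K k \<longrightarrow> b \<in> carr K \<longrightarrow>
       T (xs @ (a + b) # ys) = T (xs @ a # ys) + T (xs @ b # ys) \<and>
       T (xs @ (c *\<^sub>R a) # ys) = c *\<^sub>R T (xs @ a # ys))" (is "?L = ?R")
proof
  assume L: ?L
  show ?R
  proof (intro allI impI)
    fix xs ys :: "'a list" and a b c
    assume A: "xs @ a # ys \<in> tuples K k" and b: "b \<in> carr K"
    have "length xs < k" "a \<in> carr K" using A by (auto simp: tuples_append_Cons)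
    then show "T (xs @ (a + b) # ys) = T (xs @ a # ys) + T (xs @ b # ys) \<and>
       T (xs @ (c *\<^sub>R a) # ys) = c *\<^sub>R T (xs @ a # ys)"
      using L[unfolded multilinear_on_def, rule_format, OF A \<open>length xs < k\<close> \<open>a \<in> carr K\<close> b]
      by (simp add: list_update_append)
  qed
next
  assume R: ?R
  show ?L
    unfolding multilinear_on_def
  proof (intro ballI allI impI)
    fix hs i a b c
    assume A: "hs \<in> tuples K k" "i < k" "a \<in> carr K" "b \<in> carr K"
    have 1: "hs[i := z] = take i hs @ z # drop (Suc i) hs" for z
      using A by (intro upd_conv_take_nth_drop) (auto simp: tuples_def)
    have "set (take i hs) \<subseteq> carr K" "set (drop (Suc i) hs) \<subseteq> carr K"
      using A(1) by (auto simp: tuples_def dest: in_set_takeD in_set_dropD)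
    then have "take i hs @ a # drop (Suc i) hs \<in> tuples K k"
      using A by (auto simp: tuples_append_Cons tuples_def)
    then show "T (hs[i := a + b]) = T (hs[i := a]) + T (hs[i := b]) \<and>
       T (hs[i := c *\<^sub>R a]) = c *\<^sub>R T (hs[i := a])"
      using R A(4) unfolding 1 by blast
  qed
qed

lemma multilinear_on_add:
  assumes "multilinear_on k K T" "xs @ a # ys \<in> tuples K k" "b \<in> carr K"
  shows "T (xs @ (a + b) # ys) = T (xs @ a # ys) + T (xs @ b # ys)"
  using assms unfolding multilinear_on_iff by blast

lemma multilinear_on_scaleR:
  assumes "multilinear_on k K T" "xs @ a # ys \<in> tuples K k"
  shows "T (xs @ (c *\<^sub>R a) # ys) = c *\<^sub>R T (xs @ a # ys)"
  using assms(1)[unfolded multilinear_on_iff, rule_format, OF assms(2), of a c] assms(2)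
  by (auto simp: tuples_append_Cons)

lemma multilinear_on_diff:
  assumes "normed_carrier K" "multilinear_on k K T" "xs @ a # ys \<in> tuples K k" "b \<in> carr K"
  shows "T (xs @ (a - b) # ys) = T (xs @ a # ys) - T (xs @ b # ys)"
proof -
  have "xs @ (a - b) # ys \<in> tuples K k"
    using assms normed_carrierD(3)[OF assms(1)] by (auto simp: tuples_append_Cons)
  from multilinear_on_add[OF assms(2) this assms(4)] show ?thesis
    by (simp add: algebra_simps)
qed

lemma multilinear_on_zero:
  assumes "multilinear_on k K T" "hs \<in> tuples K k" "0 \<in> set hs"
  shows "T hs = 0"
proof -
  obtain xs ys where hs: "hs = xs @ 0 # ys" using assms(3) by (meson split_list)
  show ?thesis using multilinear_on_scaleR[of k K T xs 0 ys 0] assms unfolding hs by simp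
qed

text \<open>
  This is the homogeneity with which continuity at the zero tuple becomes a bound on all tuples.
\<close>

lemma multilinear_on_scale_all:
  assumes T: "multilinear_on k K T" and K: "normed_carrier K"
    and "xs @ ys \<in> tuples K k"
  shows "T (xs @ map (\<lambda>h. f h *\<^sub>R h) ys) = prod_list (map f ys) *\<^sub>R T (xs @ ys)"
  using assms(3)
proof (induction ys arbitrary: xs)
  case Nil
  then show ?case by simp
next
  case (Cons y ys)
  have "set (map (\<lambda>h. f h *\<^sub>R h) ys) \<subseteq> carr K"
    using Cons.prems normed_carrierD(4)[OF K] by (auto simp: tuples_def)
  then have "xs @ y # map (\<lambda>h. f h *\<^sub>R h) ys \<in> tuples K k"
    using Cons.prems by (auto simp: tuples_append_Cons)
  from multilinear_on_scaleR[OF T this, of "f y"] Cons.IH[of "xs @ [y]"] Cons.prems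
  show ?case by simp
qed

lemma prod_list_le_power:
  assumes "normed_carrier K" "set hs \<subseteq> carr K" "\<forall>h \<in> set hs. nrm K h \<le> M" "1 \<le> M"
  shows "prod_list (map (nrm K) hs) \<le> M ^ length hs"
  using assms(2,3)
proof (induction hs)
  case (Cons h hs)
  then show ?case
    using assms(4)
    by (auto intro!: mult_mono prod_list_nrm_nonneg[OF assms(1)] dest: normed_carrierD(5)[OF assms(1)])
qed simp

text \<open>Replacing the entries one at a time turns a bound into a Lipschitz estimate on bounded sets.\<close>

lemma bounded_multilinear_telescope:
  fixes C M d :: real
  assumes T: "multilinear_on k K1 T" and K: "normed_carrier K1" "normed_carrier K2"
    and val: "\<And>hs. hs \<in> tuples K1 k \<Longrightarrow> T hs \<in> carr K2"
    and bd: "\<And>hs. hs \<in> tuples K1 k \<Longrightarrow> nrm K2 (T hs) \<le> C * prod_list (map (nrm K1) hs)"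
    and C: "0 \<le> C" and M: "1 \<le> M" and d: "0 \<le> d"
    and "length ys = length ys'"
    and "xs @ ys \<in> tuples K1 k" "xs @ ys' \<in> tuples K1 k"
    and "\<forall>h \<in> set (xs @ ys @ ys'). nrm K1 h \<le> M"
    and "\<forall>i < length ys. nrm K1 (ys' ! i - ys ! i) \<le> d"
  shows "nrm K2 (T (xs @ ys') - T (xs @ ys)) \<le> length ys * (C * M ^ k * d)"
  using assms(9-)
proof (induction ys ys' arbitrary: xs rule: list_induct2)
  case Nil
  then show ?case by (simp add: normed_carrier_nrm_0[OF K(2)])
next
  case (Cons y ys y' ys')
  note t = Cons.prems(1,2)[unfolded tuples_append_Cons]
  have t1: "xs @ y' # ys' \<in> tuples K1 k" "xs @ y # ys' \<in> tuples K1 k"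
      "xs @ (y' - y) # ys' \<in> tuples K1 k"
    using Cons.hyps t normed_carrierD(3)[OF K(1)] by (auto simp: tuples_append_Cons)
  have e: "T (xs @ y' # ys') - T (xs @ y # ys)
      = T (xs @ (y' - y) # ys') + (T ((xs @ [y]) @ ys') - T ((xs @ [y]) @ ys))"
    using multilinear_on_diff[OF K(1) T t1(1), of y] t by simp
  have bounded_entry: "nrm K1 (y' - y) \<le> d" using Cons.prems(4) by (metis length_Cons nth_Cons_0 zero_less_Suc)
  have "nrm K2 (T (xs @ (y' - y) # ys')) \<le>
      C * (prod_list (map (nrm K1) (xs @ ys')) * nrm K1 (y' - y))"
    using bd[OF t1(3)] by (simp add: mult_ac)
  also have "\<dots> \<le> C * (M ^ length (xs @ ys') * d)"
    using t Cons.prems(3,4) C M d normed_carrierD(5)[OF K(1)] normed_carrierD(3)[OF K(1)]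
      bounded_entry
    by (intro mult_left_mono mult_mono prod_list_le_power[OF K(1)]) auto
  also have "\<dots> \<le> C * (M ^ k * d)"
    using t C M d by (intro mult_left_mono mult_right_mono power_increasing) auto
  finally have 1: "nrm K2 (T (xs @ (y' - y) # ys')) \<le> C * M ^ k * d" by (simp add: mult_ac)
  have 2: "nrm K2 (T ((xs @ [y]) @ ys') - T ((xs @ [y]) @ ys)) \<le> length ys * (C * M ^ k * d)"
  proof (rule Cons.IH)
    show "\<forall>i<length ys. nrm K1 (ys' ! i - ys ! i) \<le> d"
      using Cons.prems(4) by fastforce
  qed (use t t1 Cons.prems in \<open>auto simp: tuples_append_Cons\<close>)
  have "nrm K2 (T (xs @ y' # ys') - T (xs @ y # ys)) \<le>
      nrm K2 (T (xs @ (y' - y) # ys')) + nrm K2 (T ((xs @ [y]) @ ys') - T ((xs @ [y]) @ ys))"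
    unfolding e using t1 Cons.prems(1)
    by (intro normed_carrierD(8)[OF K(2)] normed_carrierD(3)[OF K(2)] val) auto
  with 1 2 show ?case by (simp add: algebra_simps)
qed

text \<open>
  The telescoping estimate shows that boundedness implies continuity, so members of the space can be
  produced from a bound alone.
\<close>

lemma multilinI:
  assumes K: "normed_carrier K1" "normed_carrier K2"
    and T: "multilinear_on k K1 T"
    and val: "\<And>hs. hs \<in> tuples K1 k \<Longrightarrow> T hs \<in> carr K2"
    and off: "\<And>hs. hs \<notin> tuples K1 k \<Longrightarrow> T hs = 0"
    and bd: "\<And>hs. hs \<in> tuples K1 k \<Longrightarrow> nrm K2 (T hs) \<le> C * prod_list (map (nrm K1) hs)"
  shows "T \<in> carr (multilin k K1 K2)"
proof -
  define C' where "C' = max C 0"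
  have bd': "nrm K2 (T hs) \<le> C' * prod_list (map (nrm K1) hs)" if "hs \<in> tuples K1 k" for hs
    using bd[OF that] prod_list_nrm_nonneg[OF K(1), of hs] that
    by (smt (verit) C'_def mem_Collect_eq mult_right_mono tuples_def)
  have "multicontinuous_on k K1 K2 T"
    unfolding multicontinuous_on_def
  proof (intro ballI allI impI)
    fix hs and e :: real
    assume hs: "hs \<in> tuples K1 k" and e: "0 < e"
    \<comment> \<open>Dominates the entries of every tuple at distance at most 1 from hs, and is at least 1, as
      the telescoping estimate requires.\<close>
    define M where "M = 1 + sum_list (map (nrm K1) hs)"
    have nn: "0 \<le> nrm K1 h" if "h \<in> set hs" for h
      using hs that normed_carrierD(5)[OF K(1)] by (auto simp: tuples_def)
    have s0: "0 \<le> sum_list (map (nrm K1) hs)" using nn by (intro sum_list_nonneg) auto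
    have M: "nrm K1 h + 1 \<le> M" if "h \<in> set hs" for h
    proof -
      have "nrm K1 h \<le> sum_list (map (nrm K1) hs)"
        using that nn by (intro member_le_sum_list) auto
      then show ?thesis by (simp add: M_def)
    qed
    define A where "A = k * (C' * M ^ k) + 1"
    have A: "0 < A" using s0 by (auto simp: A_def M_def C'_def intro!: add_nonneg_pos mult_nonneg_nonneg)
    show "\<exists>d>0. \<forall>hs' \<in> tuples K1 k. (\<forall>i<k. nrm K1 (hs' ! i - hs ! i) < d) \<longrightarrow> nrm K2 (T hs' - T hs) < e"
    proof (intro exI[of _ "min 1 (e / A)"] conjI ballI impI)
      show "0 < min 1 (e / A)" using A e by simp
      fix hs'
      assume hs': "hs' \<in> tuples K1 k" and d: "\<forall>i<k. nrm K1 (hs' ! i - hs ! i) < min 1 (e / A)"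
      have len: "length hs = k" "length hs' = k" using hs hs' by (auto simp: tuples_def)
      have C': "0 \<le> C'" by (simp add: C'_def)
      have M1: "1 \<le> M" using s0 by (simp add: M_def)
      have bM: "nrm K1 h \<le> M" if "h \<in> set hs" for h using M[OF that] by simp
      have b': "nrm K1 h \<le> M" if h: "h \<in> set hs'" for h
      proof -
        obtain i where i: "i < k" "h = hs' ! i" using h len by (metis in_set_conv_nth)
        have c: "hs ! i \<in> set hs" "hs ! i \<in> carr K1" "hs' ! i \<in> carr K1"
          using i(1) hs hs' len by (auto simp: tuples_def subset_iff)
        have "nrm K1 (hs' ! i - hs ! i + hs ! i) \<le> nrm K1 (hs' ! i - hs ! i) + nrm K1 (hs ! i)"
          by (intro normed_carrierD(8)[OF K(1)] normed_carrierD(3)[OF K(1)] c)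
        moreover have "nrm K1 (hs' ! i - hs ! i) < 1" using d i(1) by simp
        ultimately show ?thesis using M[OF c(1)] by (simp add: i(2))
      qed
      have "nrm K2 (T ([] @ hs') - T ([] @ hs)) \<le> length hs * (C' * M ^ k * (min 1 (e / A)))"
      proof (rule bounded_multilinear_telescope[OF T K val bd' C' M1])
        show "0 \<le> min 1 (e / A)" using A e by simp
        show "\<forall>h \<in> set ([] @ hs @ hs'). nrm K1 h \<le> M" using bM b' by auto
        show "\<forall>i<length hs. nrm K1 (hs' ! i - hs ! i) \<le> min 1 (e / A)"
          using d len by (auto intro: less_imp_le)
      qed (use hs hs' len in auto)
      also have "\<dots> \<le> length hs * (C' * M ^ k * (e / A))"
        using C' M1 by (intro mult_left_mono) auto
      also have "\<dots> = k * (C' * M ^ k) * (e / A)" using len by simp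
      also have "\<dots> < A * (e / A)"
        using e A by (intro mult_strict_right_mono) (auto simp: A_def)
      finally show "nrm K2 (T hs' - T hs) < e" using A by simp
    qed
  qed
  with val off T show ?thesis by (auto simp: multilin_def)
qed

lemma multilinD:
  assumes "T \<in> carr (multilin k K1 K2)"
  shows "hs \<in> tuples K1 k \<Longrightarrow> T hs \<in> carr K2"
    and "hs \<notin> tuples K1 k \<Longrightarrow> T hs = 0"
    and "multilinear_on k K1 T"
    and "multicontinuous_on k K1 K2 T"
  using assms by (auto simp: multilin_def)

text \<open>
  Conversely, continuity at the zero tuple bounds the map on a box, and scaling every argument into
  that box bounds it everywhere.  For order 0 no scaling is possible, and the only value is the bound.
\<close>

lemma multilin_has_bound:
  assumes K: "normed_carrier K1" "normed_carrier K2" and T: "T \<in> carr (multilin k K1 K2)"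
  shows "\<exists>C\<ge>0. \<forall>hs \<in> tuples K1 k. nrm K2 (T hs) \<le> C * prod_list (map (nrm K1) hs)"
proof (cases "k = 0")
  case True
  then show ?thesis
    using multilinD(1)[OF T] normed_carrierD(5)[OF K(2)]
    by (intro exI[of _ "nrm K2 (T [])"]) (auto simp: tuples_0)
next
  case False
  note ml = multilinD(3)[OF T]
  have z: "replicate k 0 \<in> tuples K1 k"
    using normed_carrierD(1)[OF K(1)] by (auto simp: tuples_def)
  have Tz: "T (replicate k 0) = 0" using False by (intro multilinear_on_zero[OF ml z]) auto
  obtain d where d: "d > 0" and
    cont: "\<And>hs. hs \<in> tuples K1 k \<Longrightarrow> (\<And>i. i < k \<Longrightarrow> nrm K1 (hs ! i) < d) \<Longrightarrow> nrm K2 (T hs) < 1"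
    using multilinD(4)[OF T, unfolded multicontinuous_on_def, rule_format, OF z, of 1] Tz
    by auto
  have bd: "nrm K2 (T hs) \<le> (2 / d) ^ k * prod_list (map (nrm K1) hs)" if hs: "hs \<in> tuples K1 k" for hs
  proof (cases "0 \<in> set hs")
    case True
    then show ?thesis
      using multilinear_on_zero[OF ml hs True] prod_list_nrm_nonneg[OF K(1), of hs] hs d
      by (auto simp: normed_carrier_nrm_0[OF K(2)] tuples_def)
  next
    case False
    have pos: "nrm K1 h > 0" if "h \<in> set hs" for h
      using that False hs normed_carrierD(5,6)[OF K(1), of h]
      by (auto simp: tuples_def less_le subset_iff)
    define f where "f h = d / 2 / nrm K1 h" for h
    define gs where "gs = map (\<lambda>h. f h *\<^sub>R h) hs"
    have gs: "gs \<in> tuples K1 k"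
      using hs normed_carrierD(4)[OF K(1)] by (auto simp: gs_def tuples_def)
    have "nrm K2 (T gs) < 1"
    proof (rule cont[OF gs])
      fix i assume "i < k"
      then have i: "hs ! i \<in> set hs" "hs ! i \<in> carr K1" "gs ! i = f (hs ! i) *\<^sub>R (hs ! i)"
        using hs by (auto simp: tuples_def gs_def)
      show "nrm K1 (gs ! i) < d"
        using pos[OF i(1)] d by (simp add: i(3) normed_carrierD(7)[OF K(1) i(2)] f_def)
    qed
    moreover have Tg: "T gs = prod_list (map f hs) *\<^sub>R T hs"
      using multilinear_on_scale_all[OF ml K(1), of "[]" hs f] hs by (simp add: gs_def)
    have pr: "prod_list (map f hs) * prod_list (map (nrm K1) hs) = (d / 2) ^ length hs"
    proof -
      have "\<forall>h \<in> set hs. f h * nrm K1 h = d / 2" using pos by (force simp: f_def)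
      then show ?thesis
      proof (induction hs)
        case (Cons h hs)
        have "prod_list (map f (h # hs)) * prod_list (map (nrm K1) (h # hs))
            = (f h * nrm K1 h) * (prod_list (map f hs) * prod_list (map (nrm K1) hs))"
          by (simp add: mult_ac)
        also have "\<dots> = (d / 2) ^ length (h # hs)" using Cons by simp
        finally show ?case .
      qed simp
    qed
    have nz: "prod_list (map (nrm K1) hs) > 0"
      using pos by (induction hs) auto
    have "prod_list (map f hs) > 0" using pr nz d by (metis half_gt_zero zero_less_mult_pos2 zero_less_power)
    then have "nrm K2 (T gs) = prod_list (map f hs) * nrm K2 (T hs)"
      using Tg normed_carrierD(7)[OF K(2) multilinD(1)[OF T hs]] by simp
    ultimately have "prod_list (map f hs) * nrm K2 (T hs) < 1" by simp
    also have "prod_list (map f hs) = (d / 2) ^ k / prod_list (map (nrm K1) hs)"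
      using pr nz hs by (auto simp: field_simps tuples_def)
    finally show ?thesis using nz d by (simp add: field_simps power_divide)
  qed
  show ?thesis using bd d by (intro exI[of _ "(2 / d) ^ k"]) auto
qed

text \<open>
  The supremum that defines the norm runs over tuples without zero entries only and is taken in the
  conditionally complete reals; boundedness makes it meaningful, and multilinearity covers the
  remaining tuples.
\<close>

lemma multilin_nrm_bound:
  assumes K: "normed_carrier K1" "normed_carrier K2" and T: "T \<in> carr (multilin k K1 K2)"
  shows "0 \<le> nrm (multilin k K1 K2) T"
    and "hs \<in> tuples K1 k \<Longrightarrow>
      nrm K2 (T hs) \<le> nrm (multilin k K1 K2) T * prod_list (map (nrm K1) hs)"
proof -
  let ?S = "{nrm K2 (T hs) / prod_list (map (nrm K1) hs) | hs. hs \<in> tuples K1 k \<and> 0 \<notin> set hs}"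
  have nrm: "nrm (multilin k K1 K2) T = Sup (insert 0 ?S)" by (simp add: multilin_def)
  have pos: "prod_list (map (nrm K1) hs) > 0" if "hs \<in> tuples K1 k" "0 \<notin> set hs" for hs
  proof -
    have "\<forall>h\<in>set hs. nrm K1 h > 0"
      using that normed_carrierD(5,6)[OF K(1)] by (auto simp: tuples_def less_le subset_iff)
    then show ?thesis by (induction hs) auto
  qed
  obtain C where C: "0 \<le> C" "\<And>hs. hs \<in> tuples K1 k \<Longrightarrow> nrm K2 (T hs) \<le> C * prod_list (map (nrm K1) hs)"
    using multilin_has_bound[OF assms] by blast
  have bdd: "bdd_above (insert 0 ?S)"
    using C pos by (intro bdd_aboveI[of _ C]) (auto simp: divide_le_eq)
  show "0 \<le> nrm (multilin k K1 K2) T" unfolding nrm by (intro cSup_upper bdd) simp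
  assume hs: "hs \<in> tuples K1 k"
  show "nrm K2 (T hs) \<le> nrm (multilin k K1 K2) T * prod_list (map (nrm K1) hs)"
  proof (cases "0 \<in> set hs")
    case True
    have "prod_list (map (nrm K1) hs) = 0"
      using True by (force simp: prod_list_zero_iff normed_carrier_nrm_0[OF K(1)] image_iff)
    then show ?thesis
      using multilinear_on_zero[OF multilinD(3)[OF T] hs True]
      by (simp add: normed_carrier_nrm_0[OF K(2)])
  next
    case False
    then have "nrm K2 (T hs) / prod_list (map (nrm K1) hs) \<le> Sup (insert 0 ?S)"
      using hs by (intro cSup_upper bdd) auto
    then show ?thesis using pos[OF hs False] by (simp add: nrm divide_le_eq)
  qed
qed

lemma multilin_nrm_le:
  assumes K: "normed_carrier K1" and "0 \<le> C"
    and "\<And>hs. hs \<in> tuples K1 k \<Longrightarrow> nrm K2 (T hs) \<le> C * prod_list (map (nrm K1) hs)"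
  shows "nrm (multilin k K1 K2) T \<le> C"
proof -
  have pos: "prod_list (map (nrm K1) hs) > 0" if "hs \<in> tuples K1 k" "0 \<notin> set hs" for hs
  proof -
    have "\<forall>h\<in>set hs. nrm K1 h > 0"
      using that normed_carrierD(5,6)[OF K(1)] by (auto simp: tuples_def less_le subset_iff)
    then show ?thesis by (induction hs) auto
  qed
  have "Sup (insert 0 {nrm K2 (T hs) / prod_list (map (nrm K1) hs) | hs. hs \<in> tuples K1 k \<and> 0 \<notin> set hs}) \<le> C"
    using assms pos by (intro cSup_least) (auto simp: divide_le_eq)
  then show ?thesis by (simp add: multilin_def)
qed

lemma normed_carrier_multilin:
  assumes K: "normed_carrier K1" "normed_carrier K2"
  shows "normed_carrier (multilin k K1 K2)"
proof -
  let ?M = "multilin k K1 K2"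
  note bound = multilin_nrm_bound[OF K]
  have add: "S + T \<in> carr ?M" "nrm ?M (S + T) \<le> nrm ?M S + nrm ?M T"
    if S: "S \<in> carr ?M" and T: "T \<in> carr ?M" for S T
  proof -
    have bd: "nrm K2 ((S + T) hs) \<le> (nrm ?M S + nrm ?M T) * prod_list (map (nrm K1) hs)"
      if "hs \<in> tuples K1 k" for hs
      using bound(2)[OF S that] bound(2)[OF T that]
        normed_carrierD(8)[OF K(2) multilinD(1)[OF S that] multilinD(1)[OF T that]]
      by (simp add: distrib_right)
    show "S + T \<in> carr ?M"
    proof (rule multilinI[OF K _ _ _ bd])
      show "multilinear_on k K1 (S + T)"
        using multilinD(3)[OF S] multilinD(3)[OF T] unfolding multilinear_on_def
        by (simp add: scaleR_add_right)
    qed (use multilinD(1,2)[OF S] multilinD(1,2)[OF T] normed_carrierD(2)[OF K(2)] in auto)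
    show "nrm ?M (S + T) \<le> nrm ?M S + nrm ?M T"
      using bound(1)[OF S] bound(1)[OF T] by (intro multilin_nrm_le[OF K(1) _ bd]) auto
  qed
  have sc: "c *\<^sub>R S \<in> carr ?M" "nrm ?M (c *\<^sub>R S) \<le> \<bar>c\<bar> * nrm ?M S"
    if S: "S \<in> carr ?M" for S c
  proof -
    have bd: "nrm K2 ((c *\<^sub>R S) hs) \<le> (\<bar>c\<bar> * nrm ?M S) * prod_list (map (nrm K1) hs)"
      if "hs \<in> tuples K1 k" for hs
      using bound(2)[OF S that] normed_carrierD(7)[OF K(2) multilinD(1)[OF S that], of c]
      by (simp add: scaleR_fun_def mult.assoc mult_left_mono)
    show "c *\<^sub>R S \<in> carr ?M"
    proof (rule multilinI[OF K _ _ _ bd])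
      show "multilinear_on k K1 (c *\<^sub>R S)"
        using multilinD(3)[OF S] unfolding multilinear_on_def scaleR_fun_def
        by (simp add: scaleR_add_right)
    qed (use multilinD(1,2)[OF S] normed_carrierD(4)[OF K(2)] in \<open>auto simp: scaleR_fun_def\<close>)
    show "nrm ?M (c *\<^sub>R S) \<le> \<bar>c\<bar> * nrm ?M S"
      using bound(1)[OF S] by (intro multilin_nrm_le[OF K(1) _ bd]) auto
  qed
  have z: "0 \<in> carr ?M"
    using normed_carrierD(1)[OF K(2)]
    by (intro multilinI[OF K, where C = 0]) (auto simp: multilinear_on_def normed_carrier_nrm_0[OF K(2)])
  show ?thesis
    unfolding normed_carrier_def
  proof (intro conjI ballI allI impI)
    show "subspace (carr ?M)" using z add sc by (intro subspaceI) auto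
    show "nrm ?M (S + T) \<le> nrm ?M S + nrm ?M T" if "S \<in> carr ?M" "T \<in> carr ?M" for S T
      using that by (rule add)
    show "0 \<le> nrm ?M S" if "S \<in> carr ?M" for S using bound(1)[OF that] .
    show "S = 0" if S: "S \<in> carr ?M" and "nrm ?M S = 0" for S
    proof
      fix hs
      show "S hs = 0 hs"
        using bound(2)[OF S, of hs] that multilinD(1,2)[OF S, of hs] normed_carrierD(5,6)[OF K(2), of "S hs"]
        by (cases "hs \<in> tuples K1 k") auto
    qed
    show "nrm ?M (c *\<^sub>R S) = \<bar>c\<bar> * nrm ?M S" if S: "S \<in> carr ?M" for S c
    proof (cases "c = 0")
      case True
      then show ?thesis using sc(2)[OF S, of 0] bound(1)[OF z] by simp
    next
      case False
      have "nrm ?M S \<le> \<bar>1 / c\<bar> * nrm ?M (c *\<^sub>R S)"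
        using sc(2)[OF sc(1)[OF S, of c], of "1 / c"] False by simp
      then show ?thesis using sc(2)[OF S, of c] False by (simp add: field_simps)
    qed
  qed
qed

section \<open>Constructions of multilinear maps\<close>

lemma multilin_1_linear:
  assumes "L \<in> carr (multilin 1 K Y)" "a \<in> carr K" "b \<in> carr K"
  shows "L [a + b] = L [a] + L [b]" and "L [c *\<^sub>R a] = c *\<^sub>R L [a]"
  using multilinear_on_add[OF multilinD(3)[OF assms(1)], of "[]" a "[]" b]
    multilinear_on_scaleR[OF multilinD(3)[OF assms(1)], of "[]" a "[]" c] assms(2,3)
  by (simp_all add: tuples_1)

text \<open>
  A Frechet derivative of a map into \<open>k\<close>-linear maps is a linear map into \<open>k\<close>-linear maps; this
  turns it into a derivative of order \<open>k + 1\<close>, with the new direction in the last place.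
\<close>

lemma multilin_uncurry:
  assumes K: "normed_carrier K" and Y: "normed_carrier Y"
    and L: "L \<in> carr (multilin 1 K (multilin k K Y))"
  shows "(\<lambda>hs. if hs \<in> tuples K (Suc k) then L [last hs] (butlast hs) else 0)
    \<in> carr (multilin (Suc k) K Y)" (is "?T \<in> _")
proof -
  note M = normed_carrier_multilin[OF K Y, of k]
  have Lc: "L [h] \<in> carr (multilin k K Y)" if "h \<in> carr K" for h
    using multilinD(1)[OF L, of "[h]"] that by (simp add: tuples_1)
  have T: "?T (gs @ [h]) = L [h] gs" if "gs \<in> tuples K k" "h \<in> carr K" for gs h
    using that by (simp add: tuples_snoc)
  show ?thesis
  proof (rule multilinI[OF K Y])
    show "multilinear_on (Suc k) K ?T"
      unfolding multilinear_on_iff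
    proof (intro allI impI)
      fix xs ys a b c
      assume t: "xs @ a # ys \<in> tuples K (Suc k)" and b: "b \<in> carr K"
      have c: "xs @ z # ys \<in> tuples K (Suc k)" if "z \<in> carr K" for z
        using t that by (auto simp: tuples_append_Cons)
      have a: "a \<in> carr K" using t by (simp add: tuples_append_Cons)
      have ab: "a + b \<in> carr K" "c *\<^sub>R a \<in> carr K"
        using a b normed_carrierD(2,4)[OF K] by auto
      show "?T (xs @ (a + b) # ys) = ?T (xs @ a # ys) + ?T (xs @ b # ys) \<and>
          ?T (xs @ (c *\<^sub>R a) # ys) = c *\<^sub>R ?T (xs @ a # ys)"
      proof (cases ys rule: rev_cases)
        case Nil
        with t have "xs \<in> tuples K k" by (simp add: tuples_snoc)
        then show ?thesis
          using a b ab multilin_1_linear[OF L a b] Nil by (simp add: scaleR_fun_def tuples_snoc)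
      next
        case (snoc zs z)
        then have z: "z \<in> carr K" and zs: "xs @ a # zs \<in> tuples K k"
          using t by (auto simp: tuples_append_Cons)
        have zs': "xs @ w # zs \<in> tuples K k" if "w \<in> carr K" for w
          using zs that by (auto simp: tuples_append_Cons)
        have e: "?T (xs @ w # ys) = L [z] (xs @ w # zs)" if "w \<in> carr K" for w
          using T[OF zs'[OF that] z] by (simp only: snoc append_assoc append_Cons)
        show ?thesis
          using multilinear_on_add[OF multilinD(3)[OF Lc[OF z]] zs b]
            multilinear_on_scaleR[OF multilinD(3)[OF Lc[OF z]] zs, of c] a b ab
          unfolding e[OF a] e[OF b] e[OF ab(1)] e[OF ab(2)] by blast
      qed
    qed
    show "?T hs \<in> carr Y" if "hs \<in> tuples K (Suc k)" for hs
      using that multilinD(1)[OF Lc] by (elim tuples_Suc_snocE) (simp add: tuples_snoc)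
    show "nrm Y (?T hs) \<le> nrm (multilin 1 K (multilin k K Y)) L * prod_list (map (nrm K) hs)"
      if "hs \<in> tuples K (Suc k)" for hs
      using that
    proof (rule tuples_Suc_snocE)
      fix gs h assume h: "hs = gs @ [h]" "gs \<in> tuples K k" "h \<in> carr K"
      have "nrm Y (L [h] gs) \<le> nrm (multilin k K Y) (L [h]) * prod_list (map (nrm K) gs)"
        by (rule multilin_nrm_bound(2)[OF K Y Lc[OF h(3)] h(2)])
      also have "\<dots> \<le> (nrm (multilin 1 K (multilin k K Y)) L * nrm K h) * prod_list (map (nrm K) gs)"
        using multilin_nrm_bound(2)[OF K M L, of "[h]"] h
        by (intro mult_right_mono prod_list_nrm_nonneg[OF K]) (auto simp: tuples_def)
      finally show ?thesis using h by (simp add: tuples_snoc mult_ac)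
    qed
  qed simp
qed

text \<open>
  Freezing the last argument is what one more differentiation in a fixed direction amounts to.
\<close>

lemma multilin_slice:
  assumes K: "normed_carrier K" and Y: "normed_carrier Y"
    and T: "T \<in> carr (multilin (Suc k) K Y)" and h: "h \<in> carr K"
  shows "(\<lambda>hs. T (hs @ [h])) \<in> carr (multilin k K Y)"
    and "nrm (multilin k K Y) (\<lambda>hs. T (hs @ [h])) \<le> nrm (multilin (Suc k) K Y) T * nrm K h"
proof -
  let ?N = "nrm (multilin (Suc k) K Y) T"
  note bound = multilin_nrm_bound[OF K Y T]
  have bd: "nrm Y (T (hs @ [h])) \<le> ?N * nrm K h * prod_list (map (nrm K) hs)" if "hs \<in> tuples K k" for hs
    using bound(2)[of "hs @ [h]"] that h by (simp add: tuples_snoc mult_ac)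
  show "(\<lambda>hs. T (hs @ [h])) \<in> carr (multilin k K Y)"
  proof (rule multilinI[OF K Y _ _ _ bd])
    show "multilinear_on k K (\<lambda>hs. T (hs @ [h]))"
      unfolding multilinear_on_iff
    proof (intro allI impI)
      fix xs ys :: "'a list" and a b c
      assume t: "xs @ a # ys \<in> tuples K k" and b: "b \<in> carr K"
      have t': "xs @ a # (ys @ [h]) \<in> tuples K (Suc k)" using t h by (auto simp: tuples_append_Cons)
      show "T ((xs @ (a + b) # ys) @ [h]) = T ((xs @ a # ys) @ [h]) + T ((xs @ b # ys) @ [h]) \<and>
          T ((xs @ (c *\<^sub>R a) # ys) @ [h]) = c *\<^sub>R T ((xs @ a # ys) @ [h])"
        using multilinear_on_add[OF multilinD(3)[OF T] t' b]
          multilinear_on_scaleR[OF multilinD(3)[OF T] t'] by simp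
    qed
  qed (use multilinD(1,2)[OF T] h in \<open>auto simp: tuples_snoc\<close>)
  show "nrm (multilin k K Y) (\<lambda>hs. T (hs @ [h])) \<le> ?N * nrm K h"
    using bound(1) normed_carrierD(5)[OF K h] bd by (intro multilin_nrm_le[OF K]) auto
qed

text \<open>
  The inverse of uncurrying, needed to exhibit a form of the next order as a Frechet derivative.
\<close>

lemma multilin_curry:
  assumes K: "normed_carrier K" and Y: "normed_carrier Y"
    and T: "T \<in> carr (multilin (Suc k) K Y)"
  shows "(\<lambda>l. if l \<in> tuples K 1 then (\<lambda>hs. T (hs @ l)) else 0)
    \<in> carr (multilin 1 K (multilin k K Y))" (is "?C \<in> _")
proof (rule multilinI[OF K normed_carrier_multilin[OF K Y]])
  have t1: "\<exists>h \<in> carr K. l = [h]" if "l \<in> tuples K 1" for l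
    using that by (cases l) (auto simp: tuples_def)
  show "multilinear_on 1 K ?C"
    unfolding multilinear_on_iff
  proof (intro allI impI)
    fix xs ys :: "'a list" and a b c
    assume t: "xs @ a # ys \<in> tuples K 1" and b: "b \<in> carr K"
    have n: "xs = []" "ys = []" and a: "a \<in> carr K" using t by (auto simp: tuples_append_Cons)
    have ab: "a + b \<in> carr K" "c *\<^sub>R a \<in> carr K" using a b normed_carrierD(2,4)[OF K] by auto
    have add: "T (hs @ [a + b]) = T (hs @ [a]) + T (hs @ [b])" for hs
    proof (cases "hs \<in> tuples K k")
      case True
      then show ?thesis
        using multilinear_on_add[OF multilinD(3)[OF T], of hs a "[]" b] a b by (simp add: tuples_snoc)
    qed (use multilinD(2)[OF T] in \<open>simp add: tuples_snoc\<close>)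
    have sc: "T (hs @ [c *\<^sub>R a]) = c *\<^sub>R T (hs @ [a])" for hs
    proof (cases "hs \<in> tuples K k")
      case True
      then show ?thesis
        using multilinear_on_scaleR[OF multilinD(3)[OF T], of hs a "[]" c] a by (simp add: tuples_snoc)
    qed (use multilinD(2)[OF T] in \<open>simp add: tuples_snoc\<close>)
    show "?C (xs @ (a + b) # ys) = ?C (xs @ a # ys) + ?C (xs @ b # ys) \<and>
        ?C (xs @ (c *\<^sub>R a) # ys) = c *\<^sub>R ?C (xs @ a # ys)"
      using a b ab add sc by (simp add: n tuples_1 scaleR_fun_def fun_eq_iff)
  qed
  show "?C l \<in> carr (multilin k K Y)" if "l \<in> tuples K 1" for l
    using t1[OF that] multilin_slice(1)[OF K Y T] by (auto simp: tuples_1)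
  show "nrm (multilin k K Y) (?C l) \<le> nrm (multilin (Suc k) K Y) T * prod_list (map (nrm K) l)"
    if "l \<in> tuples K 1" for l
    using t1[OF that] multilin_slice(2)[OF K Y T] by (auto simp: tuples_1)
qed simp

definition pullback :: "'u nspace \<Rightarrow> nat \<Rightarrow> ('u \<Rightarrow> 'w) \<Rightarrow> ('w list \<Rightarrow> 'v::zero) \<Rightarrow> 'u list \<Rightarrow> 'v"
  where "pullback K k g T = restrict_tuples K k (\<lambda>hs. T (map g hs))"

text \<open>
  The two instances of interest are \<open>R\<close> from \<open>H\<close> to \<open>H\<^sub>R\<close> and \<open>pinv R\<close> from \<open>H\<^sub>R\<close> to
  \<open>H\<close>.
\<close>

definition contraction :: "'u::real_vector nspace \<Rightarrow> 'w::real_vector nspace \<Rightarrow> ('u \<Rightarrow> 'w) \<Rightarrow> bool"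
  where "contraction K K' g \<longleftrightarrow> (\<forall>a \<in> carr K. g a \<in> carr K' \<and> nrm K' (g a) \<le> nrm K a \<and>
    (\<forall>c. g (c *\<^sub>R a) = c *\<^sub>R g a) \<and> (\<forall>b \<in> carr K. g (a + b) = g a + g b))"

lemma pullback_multilin:
  assumes K: "normed_carrier K" "normed_carrier K'" "normed_carrier Y" and g: "contraction K K' g"
    and T: "T \<in> carr (multilin k K' Y)"
  shows "pullback K k g T \<in> carr (multilin k K Y)"
    and "nrm (multilin k K Y) (pullback K k g T) \<le> nrm (multilin k K' Y) T"
proof -
  note bound = multilin_nrm_bound[OF K(2,3) T]
  have gt: "map g hs \<in> tuples K' k" if "hs \<in> tuples K k" for hs
    using that g by (auto simp: tuples_def contraction_def)
  have pr: "prod_list (map (nrm K') (map g hs)) \<le> prod_list (map (nrm K) hs)" if "set hs \<subseteq> carr K" for hs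
    using that
  proof (induction hs)
    case (Cons h hs)
    have "set (map g hs) \<subseteq> carr K'" using Cons.prems g by (auto simp: contraction_def)
    from prod_list_nrm_nonneg[OF K(2) this] show ?case
      using Cons g normed_carrierD(5)[OF K(1)] by (auto simp: contraction_def intro!: mult_mono)
  qed simp
  have bd: "nrm Y (pullback K k g T hs) \<le> nrm (multilin k K' Y) T * prod_list (map (nrm K) hs)"
    if hs: "hs \<in> tuples K k" for hs
  proof -
    have "nrm Y (T (map g hs)) \<le> nrm (multilin k K' Y) T * prod_list (map (nrm K') (map g hs))"
      by (rule bound(2)[OF gt[OF hs]])
    also have "\<dots> \<le> nrm (multilin k K' Y) T * prod_list (map (nrm K) hs)"
      using hs by (intro mult_left_mono bound(1) pr) (auto simp: tuples_def)
    finally show ?thesis using hs by (simp add: pullback_def restrict_tuples_def)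
  qed
  show "pullback K k g T \<in> carr (multilin k K Y)"
  proof (rule multilinI[OF K(1,3) _ _ _ bd])
    show "multilinear_on k K (pullback K k g T)"
      unfolding multilinear_on_iff
    proof (intro allI impI)
      fix xs ys :: "'a list" and a b c
      assume t: "xs @ a # ys \<in> tuples K k" and b: "b \<in> carr K"
      have a: "a \<in> carr K" using t by (simp add: tuples_append_Cons)
      have t': "xs @ z # ys \<in> tuples K k" if "z \<in> carr K" for z
        using t that by (auto simp: tuples_append_Cons)
      have e: "pullback K k g T (xs @ z # ys) = T (map g xs @ g z # map g ys)" if "z \<in> carr K" for z
        using t'[OF that] by (simp add: pullback_def restrict_tuples_def)
      have ab: "a + b \<in> carr K" "c *\<^sub>R a \<in> carr K" using a b normed_carrierD(2,4)[OF K(1)] by auto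
      have gab: "g (a + b) = g a + g b" "g (c *\<^sub>R a) = c *\<^sub>R g a" "g b \<in> carr K'"
        using g a b by (auto simp: contraction_def)
      have "map g xs @ g a # map g ys \<in> tuples K' k" using gt[OF t] by simp
      from multilinear_on_add[OF multilinD(3)[OF T] this gab(3)]
        multilinear_on_scaleR[OF multilinD(3)[OF T] this, of c]
      show "pullback K k g T (xs @ (a + b) # ys) =
            pullback K k g T (xs @ a # ys) + pullback K k g T (xs @ b # ys) \<and>
          pullback K k g T (xs @ (c *\<^sub>R a) # ys) = c *\<^sub>R pullback K k g T (xs @ a # ys)"
        unfolding e[OF a] e[OF b] e[OF ab(1)] e[OF ab(2)] gab(1,2) by blast
    qed
  qed (use multilinD(1)[OF T] gt in \<open>auto simp: pullback_def restrict_tuples_def\<close>)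
  show "nrm (multilin k K Y) (pullback K k g T) \<le> nrm (multilin k K' Y) T"
    by (intro multilin_nrm_le[OF K(1)] bound(1) bd)
qed

text \<open>
  An \<open>R\<close>-gradient is paired with the direction of the first differentiation; hence the new
  argument comes first.
\<close>

definition prepend :: "nat \<Rightarrow> ('a::real_inner list \<Rightarrow> 'a) \<Rightarrow> 'a list \<Rightarrow> real"
  where "prepend k G = (\<lambda>vs. if length vs = Suc k then inner (G (tl vs)) (hd vs) else 0)"

lemma prepend_multilin:
  fixes G :: "'a::real_inner list \<Rightarrow> 'a"
  assumes G: "G \<in> carr (multilin k whole whole)"
  shows "prepend k G \<in> carr (multilin (Suc k) whole whole)"
    and "nrm (multilin (Suc k) whole whole) (prepend k G) \<le> nrm (multilin k whole whole) G"
proof -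
  let ?N = "nrm (multilin k whole whole) G"
  note bound = multilin_nrm_bound[OF normed_carrier_whole normed_carrier_whole G]
  have bd: "norm (prepend k G vs) \<le> ?N * prod_list (map norm vs)" if vs: "length vs = Suc k" for vs
  proof (cases vs)
    case (Cons w us)
    have "norm (inner (G us) w) \<le> norm (G us) * norm w" by (simp add: Cauchy_Schwarz_ineq2)
    also have "\<dots> \<le> (?N * prod_list (map norm us)) * norm w"
      using bound(2)[of us] vs Cons by (intro mult_right_mono) auto
    finally show ?thesis using vs Cons by (simp add: prepend_def mult_ac)
  qed (use vs in simp)
  show "prepend k G \<in> carr (multilin (Suc k) whole whole)"
  proof (rule multilinI[OF normed_carrier_whole normed_carrier_whole, where C = ?N])
    show "multilinear_on (Suc k) whole (prepend k G)"
      unfolding multilinear_on_iff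
    proof (intro allI impI)
      fix xs ys :: "'a list" and a b c
      assume t: "xs @ a # ys \<in> tuples whole (Suc k)"
      show "prepend k G (xs @ (a + b) # ys) = prepend k G (xs @ a # ys) + prepend k G (xs @ b # ys) \<and>
          prepend k G (xs @ (c *\<^sub>R a) # ys) = c *\<^sub>R prepend k G (xs @ a # ys)"
      proof (cases xs)
        case Nil
        then show ?thesis using t by (simp add: prepend_def inner_add_right)
      next
        case (Cons w us)
        then have t': "us @ a # ys \<in> tuples whole k" using t by simp
        from multilinear_on_add[OF multilinD(3)[OF G] t', of b]
          multilinear_on_scaleR[OF multilinD(3)[OF G] t', of c]
        show ?thesis using t Cons by (simp add: prepend_def inner_add_left)
      qed
    qed
  qed (use bd in \<open>auto simp: prepend_def\<close>)
  show "nrm (multilin (Suc k) whole whole) (prepend k G) \<le> ?N"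
    using bound(1) bd by (intro multilin_nrm_le[OF normed_carrier_whole]) auto
qed

section \<open>Bounded uniformly continuous maps\<close>

lemma BUC_D:
  assumes "F \<in> BUC Y"
  shows "F x \<in> carr Y"
    and "\<exists>C. \<forall>x. nrm Y (F x) \<le> C"
    and "0 < \<epsilon> \<Longrightarrow> \<exists>\<delta>>0. \<forall>x y. dist x y < \<delta> \<longrightarrow> nrm Y (F x - F y) < \<epsilon>"
  using assms by (auto simp: BUC_def)

text \<open>
  Boundedness and uniform continuity only involve the norms of values and of differences, so they
  pass to any map that is dominated in both; all transports between forms and gradients use this.
\<close>

lemma BUC_transfer:
  assumes "F \<in> BUC Y" and "\<And>x. G x \<in> carr Z"
    and "\<And>x. nrm Z (G x) \<le> nrm Y (F x)"
    and "\<And>x y. nrm Z (G x - G y) \<le> nrm Y (F x - F y)"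
  shows "G \<in> BUC Z"
proof -
  obtain C where "\<forall>x. nrm Y (F x) \<le> C" using BUC_D(2)[OF assms(1)] ..
  then have "\<forall>x. nrm Z (G x) \<le> C" using assms(3) order_trans by blast
  moreover have "\<exists>d>0. \<forall>x y. dist x y < d \<longrightarrow> nrm Z (G x - G y) < e" if "0 < e" for e
    using BUC_D(3)[OF assms(1) that] assms(4) le_less_trans by meson
  ultimately show ?thesis using assms(2) by (auto simp: BUC_def)
qed

lemma BUC_pullback:
  assumes K: "normed_carrier K" "normed_carrier K'" "normed_carrier Y" and g: "contraction K K' g"
    and F: "F \<in> BUC (multilin k K' Y)"
  shows "(\<lambda>x. pullback K k g (F x)) \<in> BUC (multilin k K Y)"
proof (rule BUC_transfer[OF F])
  note Fc = BUC_D(1)[OF F]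
  show "pullback K k g (F x) \<in> carr (multilin k K Y)" for x
    by (rule pullback_multilin(1)[OF K g Fc])
  show "nrm (multilin k K Y) (pullback K k g (F x)) \<le> nrm (multilin k K' Y) (F x)" for x
    by (rule pullback_multilin(2)[OF K g Fc])
  have "pullback K k g (F x) - pullback K k g (F y) = pullback K k g (F x - F y)" for x y
    by (auto simp: pullback_def restrict_tuples_def fun_eq_iff)
  then show "nrm (multilin k K Y) (pullback K k g (F x) - pullback K k g (F y))
      \<le> nrm (multilin k K' Y) (F x - F y)" for x y
    using pullback_multilin(2)[OF K g normed_carrierD(3)[OF normed_carrier_multilin[OF K(2,3)] Fc Fc]]
    by simp
qed

lemma BUC_prepend:
  fixes F :: "'b::real_normed_vector \<Rightarrow> 'a::real_inner list \<Rightarrow> 'a"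
  assumes F: "F \<in> BUC (multilin k whole whole)"
  shows "(\<lambda>x. prepend k (F x)) \<in> BUC (multilin (Suc k) whole whole)"
proof (rule BUC_transfer[OF F])
  note Fc = BUC_D(1)[OF F]
  show "prepend k (F x) \<in> carr (multilin (Suc k) whole whole)" for x by (rule prepend_multilin(1)[OF Fc])
  show "nrm (multilin (Suc k) whole whole) (prepend k (F x)) \<le> nrm (multilin k whole whole) (F x)" for x
    by (rule prepend_multilin(2)[OF Fc])
  have "prepend k (F x) - prepend k (F y) = prepend k (F x - F y)" for x y
    by (auto simp: prepend_def fun_eq_iff inner_diff_left)
  then show "nrm (multilin (Suc k) whole whole) (prepend k (F x) - prepend k (F y))
      \<le> nrm (multilin k whole whole) (F x - F y)" for x y
    using prepend_multilin(2)[OF normed_carrierD(3)[OF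
          normed_carrier_multilin[OF normed_carrier_whole normed_carrier_whole] Fc Fc]] by simp
qed

text \<open>
  A form of order 0 is its value at the empty tuple, and this identification is isometric.
\<close>

lemma BUC_multilin_0_iff:
  fixes f :: "'a::real_normed_vector \<Rightarrow> real" and F :: "'a \<Rightarrow> 'b::real_normed_vector list \<Rightarrow> real"
  assumes F: "\<And>x. F x = (\<lambda>vs. if vs = [] then f x else 0)"
  shows "F \<in> BUC (multilin 0 whole whole) \<longleftrightarrow> f \<in> BUC whole"
proof -
  let ?M = "multilin 0 (whole :: 'b nspace) (whole :: real nspace)"
  have Fc: "F x \<in> carr ?M" for x
    by (rule multilinI[OF normed_carrier_whole normed_carrier_whole, where C = "\<bar>f x\<bar>"])
      (auto simp: F multilinear_on_def)
  have nrm: "nrm ?M T = \<bar>c\<bar>" if T: "T \<in> carr ?M" "T [] = c" for T c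
  proof (rule antisym)
    show "nrm ?M T \<le> \<bar>c\<bar>" using T(2) by (intro multilin_nrm_le[OF normed_carrier_whole]) auto
    show "\<bar>c\<bar> \<le> nrm ?M T"
      using multilin_nrm_bound(2)[OF normed_carrier_whole normed_carrier_whole T(1), of "[]"] T(2) by simp
  qed
  have "nrm ?M (F x) = \<bar>f x\<bar>" for x by (rule nrm[OF Fc]) (simp add: F)
  moreover have "nrm ?M (F x - F y) = \<bar>f x - f y\<bar>" for x y
    by (rule nrm, intro normed_carrierD(3) normed_carrier_multilin normed_carrier_whole Fc) (simp add: F)
  ultimately show ?thesis using Fc by (simp add: BUC_def)
qed

section \<open>Orthogonal projection and Riesz representation\<close>

text \<open>
  The parallelogram law, applied to two points of a minimising sequence and their midpoint, bounds
  the distance of the two points by their excess over the infimum.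
\<close>

lemma Cauchy_of_infimum_distance:
  fixes M :: "'a::real_inner set"
  assumes M: "subspace M" and y: "\<And>n. y n \<in> M"
    and inf: "\<And>z. z \<in> M \<Longrightarrow> d \<le> (norm (x - z))\<^sup>2"
    and lim: "\<And>n. (norm (x - y n))\<^sup>2 < d + 1 / Suc n"
  shows "Cauchy y"
proof (rule CauchyI)
  fix e :: real assume e: "0 < e"
  obtain N where N: "4 / (real N + 1) < e\<^sup>2"
  proof -
    obtain N where "4 / e\<^sup>2 < real N" using reals_Archimedean2 by blast
    then have "4 / (real N + 1) < e\<^sup>2" using e by (simp add: field_simps) (smt (verit) zero_less_power)
    then show ?thesis by (rule that)
  qed
  have "norm (y m - y n) < e" if mn: "N \<le> m" "N \<le> n" for m n
  proof -
    let ?z = "(1/2) *\<^sub>R (y m + y n)"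
    have "?z \<in> M" using M y by (intro subspace_scale subspace_add)
    then have z: "d \<le> (norm (x - ?z))\<^sup>2" by (rule inf)
    have "(norm (y m - y n))\<^sup>2 + 4 * (norm (x - ?z))\<^sup>2
        = 2 * (norm (x - y m))\<^sup>2 + 2 * (norm (x - y n))\<^sup>2"
      unfolding power2_norm_eq_inner by (simp add: algebra_simps inner_commute)
    then have "(norm (y m - y n))\<^sup>2 < 2 / Suc m + 2 / Suc n"
      using z lim[of m] lim[of n] by simp
    also have "\<dots> \<le> 2 / (real N + 1) + 2 / (real N + 1)"
      using mn by (intro add_mono divide_left_mono) auto
    also have "\<dots> < e\<^sup>2" using N by simp
    finally show ?thesis using e by (simp add: power_less_imp_less_base)
  qed
  then show "\<exists>M. \<forall>m\<ge>M. \<forall>n\<ge>M. norm (y m - y n) < e" by blast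
qed

text \<open>
  A nearest point exists by completeness, and a variation of it along \<open>z\<close> shows that the
  difference is orthogonal to \<open>z\<close>.
\<close>

lemma orthogonal_projection:
  fixes M :: "'a::{real_inner, complete_space} set"
  assumes M: "subspace M" "closed M"
  shows "\<exists>y \<in> M. x - y \<in> M\<^sup>\<bottom>"
proof -
  let ?S = "(\<lambda>z. (norm (x - z))\<^sup>2) ` M"
  define d where "d = Inf ?S"
  have bdd: "bdd_below ?S" by (intro bdd_belowI[of _ 0]) auto
  have ne: "?S \<noteq> {}" using subspace_0[OF M(1)] by auto
  have inf: "d \<le> (norm (x - z))\<^sup>2" if "z \<in> M" for z
    unfolding d_def using that by (intro cInf_lower bdd) auto
  have "\<exists>z\<in>M. (norm (x - z))\<^sup>2 < d + 1 / Suc n" for n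
    using cInf_lessD[OF ne, of "d + 1 / Suc n"] by (auto simp: d_def)
  then obtain y where y: "\<And>n. y n \<in> M" "\<And>n. (norm (x - y n))\<^sup>2 < d + 1 / Suc n" by metis
  then have "Cauchy y" using Cauchy_of_infimum_distance[OF M(1) y(1) inf y(2)] by blast
  then obtain p where p: "y \<longlonglongrightarrow> p" using Cauchy_convergent convergent_def by blast
  have pM: "p \<in> M" using closed_sequentially[OF M(2) _ p] y(1) by blast
  have "(\<lambda>n. (norm (x - y n))\<^sup>2) \<longlonglongrightarrow> (norm (x - p))\<^sup>2" by (intro tendsto_intros p)
  moreover have "(\<lambda>n. d + 1 / Suc n) \<longlonglongrightarrow> d + 0"
    by (intro tendsto_intros LIMSEQ_Suc[OF lim_1_over_n])
  ultimately have pd: "(norm (x - p))\<^sup>2 \<le> d"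
    using y(2) by (intro LIMSEQ_le[of _ _ "\<lambda>n. d + 1 / Suc n"]) (auto intro: less_imp_le)
  have "inner (x - p) z = 0" if z: "z \<in> M" for z
  proof (cases "z = 0")
    case False
    \<comment> \<open>The minimiser of the distance along the line through p in direction z.\<close>
    define t where "t = inner (x - p) z / inner z z"
    have zz: "inner z z > 0" using False by simp
    have "p + t *\<^sub>R z \<in> M" using M(1) pM z by (intro subspace_add subspace_scale)
    from inf[OF this] pd have "(norm (x - p))\<^sup>2 \<le> (norm (x - p - t *\<^sub>R z))\<^sup>2"
      unfolding diff_diff_eq by linarith
    also have "\<dots> = (norm (x - p))\<^sup>2 - 2 * t * inner (x - p) z + t * t * inner z z"
      unfolding power2_norm_eq_inner by (simp add: algebra_simps inner_commute)
    also have "\<dots> = (norm (x - p))\<^sup>2 - (inner (x - p) z)\<^sup>2 / inner z z"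
      using zz by (simp add: t_def power2_eq_square field_simps)
    finally show ?thesis using zz by (simp add: divide_le_0_iff)
  qed simp
  then show ?thesis
    using pM by (intro bexI[of _ p]) (auto simp: orthogonal_comp_def orthogonal_def inner_commute)
qed

text \<open>
  A vector orthogonal to the kernel spans a complement of it, so a multiple of it represents the
  functional.
\<close>

lemma Riesz_representation:
  fixes L :: "'a::{real_inner, complete_space} \<Rightarrow> real"
  assumes "bounded_linear L"
  shows "\<exists>l. \<forall>v. L v = inner l v"
proof (cases "\<forall>v. L v = 0")
  case True
  then show ?thesis by (intro exI[of _ 0]) simp
next
  case False
  then obtain x where x: "L x \<noteq> 0" by blast
  interpret bounded_linear L by fact
  let ?M = "{v. L v = 0}"
  have "subspace ?M" by (auto simp: subspace_def add scaleR zero)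
  moreover have "closed ?M"
    by (intro closed_Collect_eq continuous_intros linear_continuous_on assms)
  ultimately obtain y where y: "L y = 0" "x - y \<in> ?M\<^sup>\<bottom>"
    using orthogonal_projection[of ?M x] by auto
  define z where "z = x - y"
  have Lz: "L z \<noteq> 0" using x y(1) by (simp add: z_def diff)
  then have zz: "inner z z \<noteq> 0" using zero by auto
  have orth: "inner z u = 0" if "L u = 0" for u
    using y(2) that by (auto simp: z_def orthogonal_comp_def orthogonal_def inner_commute)
  show ?thesis
  proof (intro exI[of _ "(L z / inner z z) *\<^sub>R z"] allI)
    fix v
    have "inner z (v - (L v / L z) *\<^sub>R z) = 0" using Lz by (intro orth) (simp add: diff scaleR)
    then have "inner z v = (L v / L z) * inner z z" by (simp add: inner_diff_right)
    then show "L v = inner ((L z / inner z z) *\<^sub>R z) v" using Lz zz by simp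
  qed
qed

section \<open>The Hilbert space carried by the range\<close>

locale bounded_operator =
  fixes R :: "'a::{real_inner, complete_space} \<Rightarrow> 'a"
  assumes R: "bounded_linear R"
begin

lemma subspace_ker: "subspace (ker R)"
  using R by (simp add: ker_def bounded_linear.linear linear_subspace_kernel)

lemma closed_ker: "closed (ker R)"
  unfolding ker_def by (intro closed_Collect_eq continuous_intros linear_continuous_on R)

text \<open>
  Removing the component in the kernel changes neither the image under \<open>R\<close> nor inner products
  with \<open>(ker R)\<^sup>\<bottom>\<close>.
\<close>

lemma ker_perp_preimage: "\<exists>u \<in> (ker R)\<^sup>\<bottom>. R u = R v \<and> (\<forall>w \<in> (ker R)\<^sup>\<bottom>. inner w u = inner w v)"
proof -
  obtain y where y: "y \<in> ker R" "v - y \<in> (ker R)\<^sup>\<bottom>"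
    using orthogonal_projection[OF subspace_ker closed_ker] by blast
  have "R (v - y) = R v" using y(1) R by (simp add: ker_def linear_simps)
  moreover have "inner w (v - y) = inner w v" if "w \<in> (ker R)\<^sup>\<bottom>" for w
    using that y(1) by (auto simp: orthogonal_comp_def orthogonal_def inner_diff_right inner_commute)
  ultimately show ?thesis using y(2) by blast
qed

lemma inj_on_ker_perp: "inj_on R ((ker R)\<^sup>\<bottom>)"
proof (rule inj_onI)
  fix u v assume uv: "u \<in> (ker R)\<^sup>\<bottom>" "v \<in> (ker R)\<^sup>\<bottom>" "R u = R v"
  then have "u - v \<in> (ker R)\<^sup>\<bottom>" "u - v \<in> ker R"
    using R by (auto simp: subspace_diff subspace_orthogonal_comp ker_def linear_simps)
  then have "inner (u - v) (u - v) = 0" unfolding orthogonal_comp_def orthogonal_def by blast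
  then show "u = v" by simp
qed

lemma pinv_R: "u \<in> (ker R)\<^sup>\<bottom> \<Longrightarrow> pinv R (R u) = u"
  unfolding pinv_def by (rule inv_into_f_f[OF inj_on_ker_perp])

lemma pinv_range:
  assumes "h \<in> range R"
  shows "pinv R h \<in> (ker R)\<^sup>\<bottom>" and "R (pinv R h) = h"
proof -
  obtain v where "h = R v" using assms by blast
  then obtain u where "u \<in> (ker R)\<^sup>\<bottom>" "h = R u" using ker_perp_preimage[of v] by force
  then show "pinv R h \<in> (ker R)\<^sup>\<bottom>" "R (pinv R h) = h" by (simp_all add: pinv_R)
qed

lemma inner_pinv_R: "w \<in> (ker R)\<^sup>\<bottom> \<Longrightarrow> inner w (pinv R (R v)) = inner w v"
  using ker_perp_preimage[of v] pinv_R by metis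

text \<open>
  The composition \<open>pinv R \<circ> R\<close> is the orthogonal projection onto \<open>(ker R)\<^sup>\<bottom>\<close>.
\<close>

lemma norm_pinv_R_le: "norm (pinv R (R v)) \<le> norm v"
proof -
  let ?u = "pinv R (R v)"
  have "?u \<in> (ker R)\<^sup>\<bottom>" by (simp add: pinv_range)
  then have "(norm ?u)\<^sup>2 = inner ?u v" using inner_pinv_R[of ?u v] by (simp add: power2_norm_eq_inner)
  also have "\<dots> \<le> norm ?u * norm v" by (rule norm_cauchy_schwarz)
  finally show ?thesis by (cases "?u = 0") (auto simp: power2_eq_square)
qed

lemma subspace_range: "subspace (range R)"
  using R by (simp add: bounded_linear.linear linear_subspace_image subspace_UNIV)

lemma pinv_add:
  assumes "h \<in> range R" "k \<in> range R"
  shows "pinv R (h + k) = pinv R h + pinv R k"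
proof -
  have "pinv R h + pinv R k \<in> (ker R)\<^sup>\<bottom>"
    using assms by (intro subspace_add subspace_orthogonal_comp pinv_range)
  from pinv_R[OF this] show ?thesis using assms R by (simp add: linear_simps pinv_range)
qed

lemma pinv_scaleR:
  assumes "h \<in> range R"
  shows "pinv R (c *\<^sub>R h) = c *\<^sub>R pinv R h"
proof -
  have "c *\<^sub>R pinv R h \<in> (ker R)\<^sup>\<bottom>"
    using assms by (intro subspace_scale subspace_orthogonal_comp pinv_range)
  from pinv_R[OF this] show ?thesis using assms R by (simp add: linear_simps pinv_range)
qed

lemma HR_simps [simp]: "carr (HR R) = range R" "nrm (HR R) h = norm (pinv R h)"
  by (simp_all add: HR_def inner_HR_def norm_eq_sqrt_inner)

lemma ker_perp_simps [simp]: "carr (ker_perp R) = (ker R)\<^sup>\<bottom>" "nrm (ker_perp R) = norm"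
  by (simp_all add: ker_perp_def)

lemma normed_carrier_HR: "normed_carrier (HR R)"
  unfolding normed_carrier_def
proof (intro conjI ballI allI impI)
  show "v = 0" if "v \<in> carr (HR R)" "nrm (HR R) v = 0" for v
    using that pinv_range(2)[of v] R by (simp add: linear_simps)
qed (auto simp: subspace_range pinv_add pinv_scaleR norm_triangle_ineq)

lemma normed_carrier_ker_perp: "normed_carrier (ker_perp R)"
  by (auto simp: normed_carrier_def subspace_orthogonal_comp norm_triangle_ineq)

lemma map_pinv_tuples:
  "hs \<in> tuples (HR R) k \<Longrightarrow> map (pinv R) hs \<in> tuples (ker_perp R) k"
  by (auto simp: tuples_def pinv_range)

lemma map_R_tuples: "length vs = k \<Longrightarrow> map R vs \<in> tuples (HR R) k"
  by (auto simp: tuples_def)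

section \<open>Gradients representing multilinear forms\<close>

text \<open>
  The characterisation by which \<open>HR_nabla\<close> is defined, for an arbitrary form in place of the
  derivative.
\<close>

definition represents :: "nat \<Rightarrow> ('a list \<Rightarrow> real) \<Rightarrow> ('a list \<Rightarrow> 'a) \<Rightarrow> bool"
  where "represents m L G \<longleftrightarrow> G \<in> carr (multilin m (HR R) (HR R)) \<and>
    (\<forall>hs \<in> tuples (HR R) (Suc m). L hs = inner_HR R (G (butlast hs)) (last hs))"

lemma inner_HR_eqI:
  assumes "u \<in> range R" "v \<in> range R"
    and "\<And>h. h \<in> range R \<Longrightarrow> inner_HR R u h = inner_HR R v h"
  shows "u = v"
proof -
  have uv: "u - v \<in> range R" using assms by (intro subspace_diff subspace_range)
  have "inner (pinv R u - pinv R v) (pinv R (u - v)) = 0"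
    using assms(3)[OF uv] by (simp add: inner_HR_def inner_diff_left)
  moreover have "pinv R u = pinv R (u - v) + pinv R v"
    using pinv_add[OF uv assms(2)] by simp
  ultimately have "pinv R (u - v) = 0" by simp
  then have "u - v = 0" using pinv_range(2)[OF uv] R by (simp add: linear_simps)
  then show ?thesis by simp
qed

lemma inner_HR_linear:
  assumes "u \<in> range R" "v \<in> range R"
  shows "inner_HR R (u + v) h = inner_HR R u h + inner_HR R v h"
    and "inner_HR R (c *\<^sub>R u) h = c * inner_HR R u h"
    and "inner_HR R (u - v) h = inner_HR R u h - inner_HR R v h"
proof -
  have "u - v \<in> range R" using assms by (intro subspace_diff subspace_range)
  from pinv_add[OF this assms(2)]
  have "pinv R (u - v) = pinv R u - pinv R v" by (simp add: algebra_simps)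
  then show "inner_HR R (u + v) h = inner_HR R u h + inner_HR R v h"
    "inner_HR R (c *\<^sub>R u) h = c * inner_HR R u h"
    "inner_HR R (u - v) h = inner_HR R u h - inner_HR R v h"
    using assms by (simp_all add: inner_HR_def pinv_add pinv_scaleR inner_add_left inner_diff_left)
qed

lemma nrm_le_of_inner_HR:
  assumes "u \<in> range R" and "\<And>h. h \<in> range R \<Longrightarrow> inner_HR R u h \<le> C * nrm (HR R) h" and "0 \<le> C"
  shows "nrm (HR R) u \<le> C"
  using assms(2)[OF assms(1)] assms(3)
  by (cases "pinv R u = 0") (auto simp: inner_HR_def power2_norm_eq_inner[symmetric] power2_eq_square)

text \<open>
  Multilinearity and the bound are inherited from the form, because elements of the range are
  determined by their inner products in \<open>H\<^sub>R\<close> and their norm is obtained by testing an element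
  against itself.
\<close>

lemma multilin_gradientI:
  assumes L: "L \<in> carr (multilin (Suc m) (HR R) whole)"
    and val: "\<And>hs. hs \<in> tuples (HR R) m \<Longrightarrow> G hs \<in> range R"
    and off: "\<And>hs. hs \<notin> tuples (HR R) m \<Longrightarrow> G hs = 0"
    and eq: "\<And>hs h. hs \<in> tuples (HR R) m \<Longrightarrow> h \<in> range R \<Longrightarrow> inner_HR R (G hs) h = L (hs @ [h])"
  shows "represents m L G"
    and "nrm (multilin m (HR R) (HR R)) G \<le> nrm (multilin (Suc m) (HR R) whole) L"
proof -
  let ?N = "nrm (multilin (Suc m) (HR R) whole) L"
  note bound = multilin_nrm_bound[OF normed_carrier_HR normed_carrier_whole L]
  have bd: "nrm (HR R) (G hs) \<le> ?N * prod_list (map (nrm (HR R)) hs)"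
    if hs: "hs \<in> tuples (HR R) m" for hs
  proof (rule nrm_le_of_inner_HR[OF val[OF hs]])
    have nn: "0 \<le> prod_list (map (nrm (HR R)) hs)"
      using hs by (intro prod_list_nrm_nonneg[OF normed_carrier_HR]) (auto simp: tuples_def)
    then show "0 \<le> ?N * prod_list (map (nrm (HR R)) hs)" using bound(1) by simp
    show "inner_HR R (G hs) h \<le> ?N * prod_list (map (nrm (HR R)) hs) * nrm (HR R) h"
      if "h \<in> range R" for h
      using bound(2)[of "hs @ [h]"] hs that by (simp add: eq tuples_snoc)
  qed
  have "G \<in> carr (multilin m (HR R) (HR R))"
  proof (rule multilinI[OF normed_carrier_HR normed_carrier_HR _ _ off bd])
    show "multilinear_on m (HR R) G"
      unfolding multilinear_on_iff
    proof (intro allI impI)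
      fix xs ys :: "'a list" and a b c
      assume t: "xs @ a # ys \<in> tuples (HR R) m" and b: "b \<in> carr (HR R)"
      have t': "xs @ z # ys \<in> tuples (HR R) m" if "z \<in> range R" for z
        using t that by (auto simp: tuples_append_Cons)
      have a: "a \<in> range R" "b \<in> range R" using t b by (auto simp: tuples_append_Cons)
      have ab: "a + b \<in> range R" "c *\<^sub>R a \<in> range R"
        using a by (auto intro!: subspace_add subspace_scale subspace_range)
      note v = val[OF t'[OF a(1)]] val[OF t'[OF a(2)]]
      have s: "xs @ a # (ys @ [h]) \<in> tuples (HR R) (Suc m)" if "h \<in> range R" for h
        using t that by (auto simp: tuples_append_Cons)
      have "G (xs @ (a + b) # ys) = G (xs @ a # ys) + G (xs @ b # ys)"
        by (rule inner_HR_eqI)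
          (use val t' ab v b multilinear_on_add[OF multilinD(3)[OF L] s]
            in \<open>auto simp: inner_HR_linear eq t' a ab intro!: subspace_add subspace_range\<close>)
      moreover have "G (xs @ (c *\<^sub>R a) # ys) = c *\<^sub>R G (xs @ a # ys)"
        by (rule inner_HR_eqI)
          (use val t' ab v multilinear_on_scaleR[OF multilinD(3)[OF L] s]
            in \<open>auto simp: inner_HR_linear eq t' a ab intro!: subspace_scale subspace_range\<close>)
      ultimately show "G (xs @ (a + b) # ys) = G (xs @ a # ys) + G (xs @ b # ys) \<and>
          G (xs @ (c *\<^sub>R a) # ys) = c *\<^sub>R G (xs @ a # ys)" ..
    qed
  qed (use val in auto)
  then show "represents m L G"
    unfolding represents_def using eq by (auto elim!: tuples_Suc_snocE)
  show "nrm (multilin m (HR R) (HR R)) G \<le> ?N"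
    using bound(1) bd by (intro multilin_nrm_le[OF normed_carrier_HR])
qed

lemma represents_inner:
  assumes "represents m L G" "hs \<in> tuples (HR R) m" "h \<in> range R"
  shows "inner_HR R (G hs) h = L (hs @ [h])"
proof -
  have "hs @ [h] \<in> tuples (HR R) (Suc m)" using assms(2,3) by (simp add: tuples_snoc)
  from conjunct2[OF assms(1)[unfolded represents_def], rule_format, OF this]
  show ?thesis by simp
qed

lemma represents_carr: "represents m L G \<Longrightarrow> G \<in> carr (multilin m (HR R) (HR R))"
  by (simp add: represents_def)

lemma represents_range: "represents m L G \<Longrightarrow> hs \<in> tuples (HR R) m \<Longrightarrow> G hs \<in> range R"
  using multilinD(1)[OF represents_carr] by simp

lemma represents_unique:
  assumes "represents m L G" "represents m L G'"
  shows "G = G'"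
proof
  fix hs
  show "G hs = G' hs"
  proof (cases "hs \<in> tuples (HR R) m")
    case True
    show ?thesis
      using represents_inner[OF assms(1) True] represents_inner[OF assms(2) True]
        represents_range[OF assms(1) True] represents_range[OF assms(2) True]
      by (intro inner_HR_eqI) auto
  next
    case False
    then show ?thesis
      using multilinD(2)[OF represents_carr[OF assms(1)]] multilinD(2)[OF represents_carr[OF assms(2)]]
      by simp
  qed
qed

text \<open>
  Composing the last slot with \<open>R\<close> gives a bounded functional on \<open>H\<close>, to which the Riesz theorem
  for \<open>H\<close> applies; its representative lies in \<open>(ker R)\<^sup>\<bottom>\<close> because the functional vanishes
  on the kernel, and its image under \<open>R\<close> is the representative in \<open>H\<^sub>R\<close>.
\<close>

lemma represents_exists:
  assumes L: "L \<in> carr (multilin (Suc m) (HR R) whole)"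
  shows "\<exists>G. represents m L G"
proof -
  have "\<exists>l. \<forall>w. L (hs @ [R w]) = inner l w" if hs: "hs \<in> tuples (HR R) m" for hs
  proof (rule Riesz_representation, rule bounded_linear_intro)
    have t: "hs @ [R w] \<in> tuples (HR R) (Suc m)" for w using hs by (simp add: tuples_snoc)
    show "L (hs @ [R (v + w)]) = L (hs @ [R v]) + L (hs @ [R w])" for v w
      using multilinear_on_add[OF multilinD(3)[OF L] t, of "R w"] R by (simp add: linear_simps)
    show "L (hs @ [R (c *\<^sub>R v)]) = c *\<^sub>R L (hs @ [R v])" for c v
      using multilinear_on_scaleR[OF multilinD(3)[OF L] t] R by (simp add: linear_simps)
    show "norm (L (hs @ [R w])) \<le>
        norm w * (nrm (multilin (Suc m) (HR R) whole) L * prod_list (map (nrm (HR R)) hs))" for w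
    proof -
      let ?C = "nrm (multilin (Suc m) (HR R) whole) L * prod_list (map (nrm (HR R)) hs)"
      have "norm (L (hs @ [R w])) \<le> ?C * norm (pinv R (R w))"
        using multilin_nrm_bound(2)[OF normed_carrier_HR normed_carrier_whole L t]
        by (simp add: mult.assoc)
      also have "\<dots> \<le> ?C * norm w"
        using hs multilin_nrm_bound(1)[OF normed_carrier_HR normed_carrier_whole L]
        by (intro mult_left_mono norm_pinv_R_le mult_nonneg_nonneg
            prod_list_nrm_nonneg[OF normed_carrier_HR]) (auto simp: tuples_def)
      finally show ?thesis by (simp add: mult_ac)
    qed
  qed
  then obtain l where l: "\<And>hs w. hs \<in> tuples (HR R) m \<Longrightarrow> L (hs @ [R w]) = inner (l hs) w" by metis
  have lp: "l hs \<in> (ker R)\<^sup>\<bottom>" if hs: "hs \<in> tuples (HR R) m" for hs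
    unfolding orthogonal_comp_def
  proof (intro CollectI ballI)
    fix w assume w: "w \<in> ker R"
    have "L (hs @ [R w]) = 0"
      using hs w by (intro multilinear_on_zero[OF multilinD(3)[OF L]]) (auto simp: tuples_snoc ker_def)
    then show "orthogonal w (l hs)" using l[OF hs, of w] by (simp add: orthogonal_def inner_commute)
  qed
  have "represents m L (\<lambda>hs. if hs \<in> tuples (HR R) m then R (l hs) else 0)"
    by (rule multilin_gradientI(1)[OF L])
      (auto simp: inner_HR_def pinv_R[OF lp] l[symmetric] pinv_range)
  then show ?thesis by blast
qed

lemma represents_nrm:
  assumes L: "L \<in> carr (multilin (Suc m) (HR R) whole)" and G: "represents m L G"
  shows "nrm (multilin m (HR R) (HR R)) G = nrm (multilin (Suc m) (HR R) whole) L"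
proof (rule antisym)
  show "nrm (multilin m (HR R) (HR R)) G \<le> nrm (multilin (Suc m) (HR R) whole) L"
    using multilinD[of G m "HR R" "HR R"] G
    by (intro multilin_gradientI(2)[OF L]) (auto simp: represents_def tuples_snoc)
  have Gc: "G \<in> carr (multilin m (HR R) (HR R))" using G by (simp add: represents_def)
  note bound = multilin_nrm_bound[OF normed_carrier_HR normed_carrier_HR Gc]
  show "nrm (multilin (Suc m) (HR R) whole) L \<le> nrm (multilin m (HR R) (HR R)) G"
  proof (rule multilin_nrm_le[OF normed_carrier_HR bound(1)])
    fix hs assume "hs \<in> tuples (HR R) (Suc m)"
    then obtain gs h where h: "hs = gs @ [h]" "gs \<in> tuples (HR R) m" "h \<in> carr (HR R)"
      by (rule tuples_Suc_snocE)
    have "norm (L hs) \<le> norm (pinv R (G gs)) * norm (pinv R h)"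
      using represents_inner[OF G h(2), of h] h Cauchy_Schwarz_ineq2[of "pinv R (G gs)" "pinv R h"]
      by (simp add: inner_HR_def)
    also have "\<dots> \<le> nrm (multilin m (HR R) (HR R)) G * prod_list (map (nrm (HR R)) gs) * norm (pinv R h)"
      using bound(2)[OF h(2)] by (intro mult_right_mono) auto
    finally show "nrm whole (L hs) \<le> nrm (multilin m (HR R) (HR R)) G * prod_list (map (nrm (HR R)) hs)"
      by (simp add: h(1))
  qed
qed

lemma represents_diff:
  assumes L: "L \<in> carr (multilin (Suc m) (HR R) whole)" "L' \<in> carr (multilin (Suc m) (HR R) whole)"
    and G: "represents m L G" "represents m L' G'"
  shows "represents m (L - L') (G - G')"
proof (rule multilin_gradientI(1))
  show "L - L' \<in> carr (multilin (Suc m) (HR R) whole)"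
    by (intro normed_carrierD(3) normed_carrier_multilin normed_carrier_HR normed_carrier_whole L)
  show "(G - G') hs \<in> range R" if "hs \<in> tuples (HR R) m" for hs
    using represents_range[OF G(1) that] represents_range[OF G(2) that]
    by (auto intro: subspace_diff subspace_range)
  show "(G - G') hs = 0" if "hs \<notin> tuples (HR R) m" for hs
    using multilinD(2)[OF represents_carr[OF G(1)] that] multilinD(2)[OF represents_carr[OF G(2)] that]
    by simp
  show "inner_HR R ((G - G') hs) h = (L - L') (hs @ [h])" if "hs \<in> tuples (HR R) m" "h \<in> range R" for hs h
    using represents_inner[OF G(1) that] represents_inner[OF G(2) that]
      represents_range[OF G(1) that(1)] represents_range[OF G(2) that(1)]
    by (simp add: inner_HR_linear)
qed

text \<open>
  The passage from forms to gradients is linear and isometric, so the two conditions of boundedness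
  and uniform continuity are the same.
\<close>

lemma BUC_represents_iff:
  assumes L: "\<And>x. L x \<in> carr (multilin (Suc m) (HR R) whole)" and G: "\<And>x. represents m (L x) (G x)"
  shows "G \<in> BUC (multilin m (HR R) (HR R)) \<longleftrightarrow> L \<in> BUC (multilin (Suc m) (HR R) whole)"
proof -
  have 1: "nrm (multilin m (HR R) (HR R)) (G x) = nrm (multilin (Suc m) (HR R) whole) (L x)" for x
    by (rule represents_nrm[OF L G])
  have d: "L x - L y \<in> carr (multilin (Suc m) (HR R) whole)" for x y
    by (intro normed_carrierD(3) normed_carrier_multilin normed_carrier_HR normed_carrier_whole L)
  have 2: "nrm (multilin m (HR R) (HR R)) (G x - G y) = nrm (multilin (Suc m) (HR R) whole) (L x - L y)" for x y
    by (rule represents_nrm[OF d represents_diff[OF L L G G]])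
  have 3: "G x \<in> carr (multilin m (HR R) (HR R))" for x using G by (simp add: represents_def)
  show ?thesis unfolding BUC_def using L 1 2 3 by simp
qed

end

text \<open>
  The identity operator gives back \<open>H\<close> itself, so everything about gradients in \<open>H\<^sub>R\<close> applies
  to gradients in \<open>H\<close>.
\<close>

lemma HR_id: "HR (\<lambda>x. x) = (whole :: 'a::real_inner nspace)" "inner_HR (\<lambda>x. x) = (inner :: 'a \<Rightarrow> _)"
proof -
  have "ker (\<lambda>x. x :: 'a)\<^sup>\<bottom> = UNIV" by (auto simp: ker_def orthogonal_comp_def orthogonal_def)
  then have "pinv (\<lambda>x. x :: 'a) = (\<lambda>x. x)"
    by (auto simp: pinv_def fun_eq_iff inv_into_f_f[of "\<lambda>x. x"])
  then show "HR (\<lambda>x. x) = (whole :: 'a nspace)" "inner_HR (\<lambda>x. x) = (inner :: 'a \<Rightarrow> _)"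
    by (auto simp: HR_def whole_def inner_HR_def fun_eq_iff norm_eq_sqrt_inner)
qed

lemma bounded_operator_id: "bounded_operator (\<lambda>x::'a::{real_inner, complete_space}. x)"
  unfolding bounded_operator_def by (rule bounded_linear_ident)

abbreviation gradient_of ::
    "nat \<Rightarrow> ('a::{real_inner, complete_space} list \<Rightarrow> real) \<Rightarrow> ('a list \<Rightarrow> 'a) \<Rightarrow> bool"
  where "gradient_of \<equiv> bounded_operator.represents (\<lambda>x. x)"

lemmas gradient_of_def = bounded_operator.represents_def[OF bounded_operator_id, unfolded HR_id]
lemmas gradient_of_exists = bounded_operator.represents_exists[OF bounded_operator_id, unfolded HR_id]
lemmas BUC_gradient_of_iff = bounded_operator.BUC_represents_iff[OF bounded_operator_id, unfolded HR_id]
lemmas gradient_nrm_le = bounded_operator.multilin_gradientI(2)[OF bounded_operator_id, unfolded HR_id]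

lemma gradient_of_inner: "gradient_of m L G \<Longrightarrow> length vs = m \<Longrightarrow> inner (G vs) w = L (vs @ [w])"
  by (simp add: gradient_of_def)

lemma gradient_of_carr: "gradient_of m L G \<Longrightarrow> G \<in> carr (multilin m whole whole)"
  by (simp add: gradient_of_def)

section \<open>Frechet derivatives along the range\<close>

context bounded_operator
begin

lemma has_HR_derivative_carr: "has_HR_derivative_at R Y f x L \<Longrightarrow> L \<in> carr (multilin 1 (HR R) Y)"
  by (simp add: has_HR_derivative_at_def)

text \<open>
  A weak inequality without division, which allows the increment to be zero, is equivalent to the
  condition on quotients and easier to combine with other estimates.
\<close>

lemma has_HR_derivative_atI:
  assumes "L \<in> carr (multilin 1 (HR R) Y)"
    and "\<And>\<epsilon>. 0 < \<epsilon> \<Longrightarrow> \<exists>\<delta>>0. \<forall>h \<in> range R. norm (pinv R h) < \<delta> \<longrightarrow>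
      nrm Y (f (x + h) - f x - L [h]) \<le> \<epsilon> * norm (pinv R h)"
  shows "has_HR_derivative_at R Y f x L"
  unfolding has_HR_derivative_at_def
proof (intro conjI allI impI)
  fix e :: real assume "0 < e"
  then obtain d where d: "d > 0" "\<forall>h \<in> range R. norm (pinv R h) < d \<longrightarrow>
      nrm Y (f (x + h) - f x - L [h]) \<le> e / 2 * norm (pinv R h)"
    using assms(2)[of "e / 2"] by auto
  then have d2: "nrm Y (f (x + h) - f x - L [h]) \<le> e / 2 * norm (pinv R h)"
    if "h \<in> range R" "norm (pinv R h) < d" for h using that by blast
  show "\<exists>d>0. \<forall>h\<in>carr (HR R). 0 < nrm (HR R) h \<and> nrm (HR R) h < d \<longrightarrow>
      nrm Y (f (x + h) - f x - L [h]) / nrm (HR R) h < e"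
  proof (intro exI[of _ d] conjI ballI impI)
    fix h assume h: "h \<in> carr (HR R)" "0 < nrm (HR R) h \<and> nrm (HR R) h < d"
    then have "nrm Y (f (x + h) - f x - L [h]) \<le> e / 2 * norm (pinv R h)" by (intro d2) auto
    also have "\<dots> < e * norm (pinv R h)" using h \<open>0 < e\<close> by simp
    finally show "nrm Y (f (x + h) - f x - L [h]) / nrm (HR R) h < e"
      using h(2) by (simp add: divide_less_eq)
  qed (use d in simp)
qed (fact assms(1))

lemma has_HR_derivative_atD:
  assumes Y: "normed_carrier Y" and L: "has_HR_derivative_at R Y f x L" and "0 < \<epsilon>"
  shows "\<exists>\<delta>>0. \<forall>h \<in> range R. norm (pinv R h) < \<delta> \<longrightarrow>
      nrm Y (f (x + h) - f x - L [h]) \<le> \<epsilon> * norm (pinv R h)"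
proof -
  obtain d where d: "d > 0" "\<forall>h\<in>range R. 0 < norm (pinv R h) \<and> norm (pinv R h) < d \<longrightarrow>
      nrm Y (f (x + h) - f x - L [h]) / norm (pinv R h) < \<epsilon>"
    using L \<open>0 < \<epsilon>\<close> unfolding has_HR_derivative_at_def by auto
  show ?thesis
  proof (intro exI[of _ d] conjI ballI impI)
    fix h assume h: "h \<in> range R" "norm (pinv R h) < d"
    show "nrm Y (f (x + h) - f x - L [h]) \<le> \<epsilon> * norm (pinv R h)"
    proof (cases "pinv R h = 0")
      case True
      then have "h = 0" using pinv_range(2)[OF h(1)] R by (simp add: linear_simps)
      moreover have "L [0] = 0"
        using multilin_1_linear(2)[OF has_HR_derivative_carr[OF L], of 0 0 0] h(1) \<open>h = 0\<close> by simp
      ultimately show ?thesis using True by (simp add: normed_carrier_nrm_0[OF Y])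
    next
      case False
      then show ?thesis using d(2) h by (force simp: divide_less_eq)
    qed
  qed (use d in simp)
qed

text \<open>
  Two derivatives differ at \<open>t h\<close> by an error that is small compared with \<open>t\<close>; dividing by \<open>t\<close>
  shows that they agree at \<open>h\<close>.
\<close>

lemma has_HR_derivative_unique:
  assumes Y: "normed_carrier Y" and f: "\<And>y. f y \<in> carr Y"
    and L: "has_HR_derivative_at R Y f x L" and L': "has_HR_derivative_at R Y f x L'"
  shows "L = L'"
proof
  fix hs
  note c = has_HR_derivative_carr[OF L] has_HR_derivative_carr[OF L']
  show "L hs = L' hs"
  proof (cases "hs \<in> tuples (HR R) 1")
    case False
    then show ?thesis using multilinD(2)[OF c(1)] multilinD(2)[OF c(2)] by simp
  next
    case True
    then obtain h where h: "hs = [h]" "h \<in> range R"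
      by (cases hs) (auto simp: tuples_def)
    have Lc: "L [h] \<in> carr Y" "L' [h] \<in> carr Y"
      using multilinD(1)[OF c(1)] multilinD(1)[OF c(2)] True h(1) by auto
    let ?p = "norm (pinv R h)"
    have "nrm Y (L [h] - L' [h]) \<le> 0 + e" if "0 < e" for e
    proof -
      \<comment> \<open>Both errors have to fit into e after multiplication by the norm of h; adding 1 avoids
        division by zero.\<close>
      define e' where "e' = e / (2 * (?p + 1))"
      have e': "0 < e'" using that by (simp add: e'_def add_nonneg_pos)
      obtain d where d: "d > 0" "\<And>k. k \<in> range R \<Longrightarrow> norm (pinv R k) < d \<Longrightarrow>
          nrm Y (f (x + k) - f x - L [k]) \<le> e' * norm (pinv R k)"
        using has_HR_derivative_atD[OF Y L e'] by blast
      obtain d' where d': "d' > 0" "\<And>k. k \<in> range R \<Longrightarrow> norm (pinv R k) < d' \<Longrightarrow>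
          nrm Y (f (x + k) - f x - L' [k]) \<le> e' * norm (pinv R k)"
        using has_HR_derivative_atD[OF Y L' e'] by blast
      define t where "t = min d d' / (2 * (?p + 1))"
      have t: "t > 0" using d(1) d'(1) by (simp add: t_def add_nonneg_pos)
      have "t * ?p \<le> t * (?p + 1)" using t by (intro mult_left_mono) auto
      also have "t * (?p + 1) = min d d' / 2"
        unfolding t_def by (simp add: field_simps add_nonneg_eq_0_iff)
      finally have tp: "t * ?p < d" "t * ?p < d'" using d(1) d'(1) by auto
      have th: "t *\<^sub>R h \<in> range R" using h(2) by (intro subspace_scale subspace_range)
      have nth: "norm (pinv R (t *\<^sub>R h)) = t * ?p" using t h(2) by (simp add: pinv_scaleR)
      let ?k = "t *\<^sub>R h"
      have Lk: "L [?k] = t *\<^sub>R L [h]" "L' [?k] = t *\<^sub>R L' [h]"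
        using multilin_1_linear(2)[OF c(1), of h h] multilin_1_linear(2)[OF c(2), of h h] h(2) by auto
      have Lkc: "L [?k] \<in> carr Y" "L' [?k] \<in> carr Y"
        unfolding Lk using Lc normed_carrierD(4)[OF Y] by auto
      have fc: "f (x + ?k) - f x \<in> carr Y" using f normed_carrierD(3)[OF Y] by auto
      have "t * nrm Y (L [h] - L' [h]) = nrm Y (L [?k] - L' [?k])"
        using normed_carrierD(7)[OF Y normed_carrierD(3)[OF Y Lc], of t] t
        by (simp add: Lk scaleR_diff_right)
      also have "\<dots> = nrm Y ((f (x + ?k) - f x - L' [?k]) + (-1) *\<^sub>R (f (x + ?k) - f x - L [?k]))"
        by (simp add: algebra_simps)
      also have "\<dots> \<le> nrm Y (f (x + ?k) - f x - L' [?k]) + nrm Y (f (x + ?k) - f x - L [?k])"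
        using normed_carrierD(8)[OF Y normed_carrierD(3)[OF Y fc Lkc(2)]
            normed_carrierD(4)[OF Y normed_carrierD(3)[OF Y fc Lkc(1)], of "-1"]]
          normed_carrierD(7)[OF Y normed_carrierD(3)[OF Y fc Lkc(1)], of "-1"] by simp
      also have "\<dots> \<le> e' * (t * ?p) + e' * (t * ?p)"
        using d(2)[OF th] d'(2)[OF th] tp nth by (intro add_mono) auto
      finally have "t * nrm Y (L [h] - L' [h]) \<le> t * (2 * e' * ?p)" by (simp add: mult_ac)
      then have "nrm Y (L [h] - L' [h]) \<le> 2 * e' * ?p" using t by simp
      also have "\<dots> \<le> 2 * e' * (?p + 1)" using e' by (intro mult_left_mono) auto
      also have "\<dots> = e" by (simp add: e'_def field_simps add_nonneg_eq_0_iff)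
      finally show ?thesis by simp
    qed
    then have "nrm Y (L [h] - L' [h]) \<le> 0" by (rule field_le_epsilon)
    then have "L [h] - L' [h] = 0"
      using normed_carrierD(3,5,6)[OF Y] Lc by (meson antisym)
    then show ?thesis by (simp add: h(1))
  qed
qed

lemma HR_D_eq:
  assumes "normed_carrier Y" "\<And>y. f y \<in> carr Y" "has_HR_derivative_at R Y f x L"
  shows "HR_D R Y f x = L" and "HR_differentiable_at R Y f x"
  unfolding HR_D_def HR_differentiable_at_def
  using has_HR_derivative_unique[OF assms(1,2) _ assms(3)] assms(3) by blast+

lemma HR_D_works: "HR_differentiable_at R Y f x \<Longrightarrow> has_HR_derivative_at R Y f x (HR_D R Y f x)"
  unfolding HR_D_def HR_differentiable_at_def by (rule theI'[of "has_HR_derivative_at R Y f x"])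

text \<open>
  \<open>HR_Dk\<close> differentiates the value at a fixed tuple, whereas differentiability is demanded of the map
  into the space of multilinear maps.  Evaluation is bounded and linear, so the latter implies the
  former, with the evaluated derivative.
\<close>

lemma has_HR_derivative_evaluate:
  assumes Y: "normed_carrier Y" and F: "\<And>y. F y \<in> carr (multilin k (HR R) Y)"
    and L: "has_HR_derivative_at R (multilin k (HR R) Y) F x L" and gs: "gs \<in> tuples (HR R) k"
  shows "has_HR_derivative_at R Y (\<lambda>y. F y gs) x (\<lambda>hs. L hs gs)"
proof -
  note M = normed_carrier_multilin[OF normed_carrier_HR Y, of k]
  note Lc = has_HR_derivative_carr[OF L]
  let ?P = "prod_list (map (nrm (HR R)) gs)"
  have P: "0 \<le> ?P" using gs by (intro prod_list_nrm_nonneg[OF normed_carrier_HR]) (auto simp: tuples_def)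
  show ?thesis
  proof (rule has_HR_derivative_atI)
    show "(\<lambda>hs. L hs gs) \<in> carr (multilin 1 (HR R) Y)"
    proof (rule multilinI[OF normed_carrier_HR Y])
      show "multilinear_on 1 (HR R) (\<lambda>hs. L hs gs)"
        using multilinD(3)[OF Lc] unfolding multilinear_on_def by (simp add: scaleR_fun_def)
      show "L hs gs \<in> carr Y" if "hs \<in> tuples (HR R) 1" for hs
        using multilinD(1)[OF multilinD(1)[OF Lc that] gs] .
      show "L hs gs = 0" if "hs \<notin> tuples (HR R) 1" for hs
        using multilinD(2)[OF Lc that] by simp
      show "nrm Y (L hs gs) \<le> (nrm (multilin 1 (HR R) (multilin k (HR R) Y)) L * ?P) * prod_list (map (nrm (HR R)) hs)"
        if "hs \<in> tuples (HR R) 1" for hs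
      proof -
        have "nrm Y (L hs gs) \<le> nrm (multilin k (HR R) Y) (L hs) * ?P"
          by (rule multilin_nrm_bound(2)[OF normed_carrier_HR Y multilinD(1)[OF Lc that] gs])
        also have "\<dots> \<le> (nrm (multilin 1 (HR R) (multilin k (HR R) Y)) L * prod_list (map (nrm (HR R)) hs)) * ?P"
          by (intro mult_right_mono P multilin_nrm_bound(2)[OF normed_carrier_HR M Lc that])
        finally show ?thesis by (simp add: mult_ac)
      qed
    qed
    fix e :: real assume e: "0 < e"
    have e': "0 < e / (?P + 1)" using e P by simp
    obtain d where d: "d > 0" "\<And>h. h \<in> range R \<Longrightarrow> norm (pinv R h) < d \<Longrightarrow>
        nrm (multilin k (HR R) Y) (F (x + h) - F x - L [h]) \<le> e / (?P + 1) * norm (pinv R h)"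
      using has_HR_derivative_atD[OF M L e'] by blast
    show "\<exists>d>0. \<forall>h\<in>range R. norm (pinv R h) < d \<longrightarrow>
        nrm Y (F (x + h) gs - F x gs - L [h] gs) \<le> e * norm (pinv R h)"
    proof (intro exI[of _ d] conjI ballI impI)
      fix h assume h: "h \<in> range R" "norm (pinv R h) < d"
      have c: "F (x + h) - F x - L [h] \<in> carr (multilin k (HR R) Y)"
        using F multilinD(1)[OF Lc, of "[h]"] h(1)
        by (intro normed_carrierD(3)[OF M]) (auto simp: tuples_def)
      have "nrm Y ((F (x + h) - F x - L [h]) gs) \<le> (e / (?P + 1) * norm (pinv R h)) * ?P"
        using multilin_nrm_bound(2)[OF normed_carrier_HR Y c gs] mult_right_mono[OF d(2)[OF h] P]
        by linarith
      also have "\<dots> = (e * norm (pinv R h)) * (?P / (?P + 1))" by simp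
      also have "\<dots> \<le> (e * norm (pinv R h)) * 1"
        using P e by (intro mult_left_mono) auto
      finally show "nrm Y (F (x + h) gs - F x gs - L [h] gs) \<le> e * norm (pinv R h)" by simp
    qed (use d in simp)
  qed
qed

lemma has_HR_derivative_directional:
  assumes L: "has_HR_derivative_at R whole g x L" and h: "h \<in> range R"
  shows "((\<lambda>s. g (x + s *\<^sub>R h)) has_real_derivative L [h]) (at 0)"
  unfolding DERIV_def
proof (rule LIM_I)
  fix e :: real assume e: "0 < e"
  let ?p = "norm (pinv R h) + 1"
  have e': "0 < e / (2 * ?p)" using e by (simp add: add_nonneg_pos)
  obtain d where d: "d > 0" "\<And>k. k \<in> range R \<Longrightarrow> norm (pinv R k) < d \<Longrightarrow>
      norm (g (x + k) - g x - L [k]) \<le> e / (2 * ?p) * norm (pinv R k)"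
    using has_HR_derivative_atD[OF normed_carrier_whole L e'] by auto
  show "\<exists>s>0. \<forall>t. t \<noteq> 0 \<and> norm (t - 0) < s \<longrightarrow>
      norm ((g (x + (0 + t) *\<^sub>R h) - g (x + 0 *\<^sub>R h)) / t - L [h]) < e"
  proof (intro exI[of _ "d / ?p"] conjI allI impI)
    show "0 < d / ?p" using d by (simp add: add_nonneg_pos)
    fix t :: real assume t: "t \<noteq> 0 \<and> norm (t - 0) < d / ?p"
    have n: "norm (pinv R (t *\<^sub>R h)) = \<bar>t\<bar> * norm (pinv R h)" using h by (simp add: pinv_scaleR)
    have "\<bar>t\<bar> * norm (pinv R h) \<le> \<bar>t\<bar> * ?p" by (intro mult_left_mono) auto
    also have "\<dots> < d" using t by (simp add: less_divide_eq add_nonneg_pos)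
    finally have "norm (g (x + t *\<^sub>R h) - g x - L [t *\<^sub>R h]) \<le> e / (2 * ?p) * (\<bar>t\<bar> * norm (pinv R h))"
      using d(2)[of "t *\<^sub>R h"] h n by (auto intro: subspace_scale subspace_range)
    also have "\<dots> \<le> e / (2 * ?p) * (\<bar>t\<bar> * ?p)"
      using e' by (intro mult_left_mono) auto
    also have "\<dots> = e / 2 * \<bar>t\<bar>" by (simp add: field_simps add_nonneg_eq_0_iff)
    also have "\<dots> < e * \<bar>t\<bar>" using e t by simp
    finally have *: "norm (g (x + t *\<^sub>R h) - g x - t * L [h]) < e * \<bar>t\<bar>"
      using multilin_1_linear(2)[OF has_HR_derivative_carr[OF L], of h h t] h by simp
    have "(g (x + (0 + t) *\<^sub>R h) - g (x + 0 *\<^sub>R h)) / t - L [h] = (g (x + t *\<^sub>R h) - g x - t * L [h]) / t"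
      using t by (simp add: field_simps)
    then show "norm ((g (x + (0 + t) *\<^sub>R h) - g (x + 0 *\<^sub>R h)) / t - L [h]) < e"
      using * t by (simp add: divide_less_eq)
  qed
qed

text \<open>
  Every derivative of order \<open>k + 2\<close> is the uncurried derivative of the one of order \<open>k + 1\<close>.
\<close>

lemma HR_Dk_carr:
  assumes "HR_times_differentiable R (whole :: real nspace) (Suc k) f"
  shows "HR_Dk R whole (Suc k) f x \<in> carr (multilin (Suc k) (HR R) whole)"
  using assms
proof (induction k arbitrary: x)
  case 0
  then show ?case using HR_D_works has_HR_derivative_carr by fastforce
next
  case (Suc k)
  let ?M = "multilin (Suc k) (HR R) (whole :: real nspace)"
  let ?F = "HR_Dk R (whole :: real nspace) (Suc k) f"
  have F: "?F y \<in> carr ?M" for y using Suc by simp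
  have d: "has_HR_derivative_at R ?M ?F x (HR_D R ?M ?F x)"
    using Suc.prems by (simp add: HR_D_works)
  have "HR_Dk R whole (Suc (Suc k)) f x =
      (\<lambda>hs. if hs \<in> tuples (HR R) (Suc (Suc k)) then HR_D R ?M ?F x [last hs] (butlast hs) else 0)"
  proof
    fix hs
    show "HR_Dk R whole (Suc (Suc k)) f x hs =
      (if hs \<in> tuples (HR R) (Suc (Suc k)) then HR_D R ?M ?F x [last hs] (butlast hs) else 0)"
    proof (cases "hs \<in> tuples (HR R) (Suc (Suc k))")
      case True
      then have "butlast hs \<in> tuples (HR R) (Suc k)" by (rule tuples_Suc_snocE) simp
      from HR_D_eq(1)[OF normed_carrier_whole _ has_HR_derivative_evaluate[OF normed_carrier_whole F d this]]
      show ?thesis using True by simp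
    qed simp
  qed
  then show ?case
    using multilin_uncurry[OF normed_carrier_HR normed_carrier_whole has_HR_derivative_carr[OF d]]
    by simp
qed

lemma HR_Dk_directional:
  assumes "HR_times_differentiable R (whole :: real nspace) (Suc (Suc k)) f"
    and gs: "gs \<in> tuples (HR R) (Suc k)" and h: "h \<in> range R"
  shows "((\<lambda>s. HR_Dk R whole (Suc k) f (x + s *\<^sub>R h) gs) has_real_derivative
    HR_Dk R whole (Suc (Suc k)) f x (gs @ [h])) (at 0)"
proof -
  let ?M = "multilin (Suc k) (HR R) (whole :: real nspace)"
  let ?F = "HR_Dk R (whole :: real nspace) (Suc k) f"
  have F: "?F y \<in> carr ?M" for y using assms(1) by (intro HR_Dk_carr) simp
  have d: "has_HR_derivative_at R ?M ?F x (HR_D R ?M ?F x)"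
    using assms(1) by (simp add: HR_D_works)
  note e = has_HR_derivative_evaluate[OF normed_carrier_whole F d gs]
  have "HR_Dk R whole (Suc (Suc k)) f x (gs @ [h]) = HR_D R ?M ?F x [h] gs"
    using gs h HR_D_eq(1)[OF normed_carrier_whole _ e] by (simp add: tuples_snoc)
  with has_HR_derivative_directional[OF e h] show ?thesis by simp
qed

lemma represents_HR_nabla_iff:
  assumes "HR_Dk R whole (Suc m) f x \<in> carr (multilin (Suc m) (HR R) whole)"
  shows "represents m (HR_Dk R whole (Suc m) f x) G \<longleftrightarrow> HR_nabla R (Suc m) f x = G"
proof -
  obtain G' where G': "represents m (HR_Dk R whole (Suc m) f x) G'"
    using represents_exists[OF assms] by blast
  have "HR_nabla R (Suc m) f x = (THE G. represents m (HR_Dk R whole (Suc m) f x) G)"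
    by (simp only: HR_nabla_def represents_def diff_Suc_1)
  also have "\<dots> = G'" using G' represents_unique by (intro the_equality)
  finally show ?thesis using G' represents_unique by blast
qed

lemma HR_times_differentiable_mono:
  assumes "HR_times_differentiable R Y n f" "k \<le> n"
  shows "HR_times_differentiable R Y k f"
  using assms(2,1)
proof (induction n rule: dec_induct)
  case (step n)
  then show ?case by (cases n) auto
qed simp

lemma BUC_HR_nabla_iff:
  assumes "\<And>x. HR_Dk R whole (Suc m) f x \<in> carr (multilin (Suc m) (HR R) whole)"
  shows "HR_nabla R (Suc m) f \<in> BUC (multilin m (HR R) (HR R)) \<longleftrightarrow>
    HR_Dk R whole (Suc m) f \<in> BUC (multilin (Suc m) (HR R) whole)"
  by (rule BUC_represents_iff[OF assms]) (use represents_HR_nabla_iff[OF assms] in blast)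

end

section \<open>Symmetry of second directional derivatives\<close>

lemma directional_DERIV_iff:
  fixes g :: "'a::real_normed_vector \<Rightarrow> real"
  shows "((\<lambda>s. g (x + s *\<^sub>R u)) has_real_derivative d) (at 0) \<longleftrightarrow>
    ((\<lambda>s. (g (x + s *\<^sub>R u) - g x) / s) \<longlongrightarrow> d) (at 0)"
  by (simp add: DERIV_def)

text \<open>
  The hypothesis holds at every base point, so a derivative at \<open>0\<close> gives derivatives along the whole
  line.
\<close>

lemma directional_DERIV_shift:
  fixes g :: "'a::real_normed_vector \<Rightarrow> real"
  assumes "\<And>y. ((\<lambda>s. g (y + s *\<^sub>R u)) has_real_derivative g' y) (at 0)"
  shows "((\<lambda>s. g (y + s *\<^sub>R u)) has_real_derivative g' (y + t *\<^sub>R u)) (at t)"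
proof -
  have "((\<lambda>s. g (y + (s + t) *\<^sub>R u)) has_real_derivative g' (y + t *\<^sub>R u)) (at 0)"
    using assms[of "y + t *\<^sub>R u"] by (simp add: algebra_simps)
  then show ?thesis using DERIV_shift[of "\<lambda>s. g (y + s *\<^sub>R u)" _ 0 t] by simp
qed

lemma directional_mvt:
  fixes g :: "'a::real_normed_vector \<Rightarrow> real"
  assumes "\<And>y. ((\<lambda>s. g (y + s *\<^sub>R u)) has_real_derivative g' y) (at 0)"
  shows "\<exists>\<xi>. 0 \<le> \<xi> \<and> \<xi> \<le> 1 \<and> g (y + u) - g y = g' (y + \<xi> *\<^sub>R u)"
proof -
  obtain z where "0 < z" "z < 1" "g (y + 1 *\<^sub>R u) - g (y + 0 *\<^sub>R u) = (1 - 0) * g' (y + z *\<^sub>R u)"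
    using MVT2[of 0 1 "\<lambda>s. g (y + s *\<^sub>R u)" "\<lambda>s. g' (y + s *\<^sub>R u)"] directional_DERIV_shift[OF assms]
    by auto
  then show ?thesis by (intro exI[of _ z]) auto
qed

text \<open>
  The mean value theorem is used once in each direction, first for the increment of the function in
  the second direction.
\<close>

lemma second_difference_mvt:
  fixes g :: "'a::real_normed_vector \<Rightarrow> real"
  assumes a: "\<And>y. ((\<lambda>s. g (y + s *\<^sub>R a)) has_real_derivative ga y) (at 0)"
    and ab: "\<And>y. ((\<lambda>s. ga (y + s *\<^sub>R b)) has_real_derivative gab y) (at 0)"
    and t: "0 < t"
  shows "\<exists>\<xi> \<eta>. 0 \<le> \<xi> \<and> \<xi> \<le> t \<and> 0 \<le> \<eta> \<and> \<eta> \<le> t \<and>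
    g (x + t *\<^sub>R a + t *\<^sub>R b) - g (x + t *\<^sub>R a) - g (x + t *\<^sub>R b) + g x
      = t * t * gab (x + \<xi> *\<^sub>R a + \<eta> *\<^sub>R b)"
proof -
  have "((\<lambda>s. g (x + t *\<^sub>R b + s *\<^sub>R a) - g (x + s *\<^sub>R a)) has_real_derivative
      ga (x + t *\<^sub>R b + s *\<^sub>R a) - ga (x + s *\<^sub>R a)) (at s)" for s
    by (rule DERIV_diff[OF directional_DERIV_shift[OF a] directional_DERIV_shift[OF a]])
  then obtain \<xi> where \<xi>: "0 < \<xi>" "\<xi> < t"
    "g (x + t *\<^sub>R b + t *\<^sub>R a) - g (x + t *\<^sub>R a) - (g (x + t *\<^sub>R b) - g x)
      = t * (ga (x + t *\<^sub>R b + \<xi> *\<^sub>R a) - ga (x + \<xi> *\<^sub>R a))"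
    using MVT2[OF t, of "\<lambda>s. g (x + t *\<^sub>R b + s *\<^sub>R a) - g (x + s *\<^sub>R a)"] by force
  obtain \<eta> where \<eta>: "0 < \<eta>" "\<eta> < t"
    "ga (x + \<xi> *\<^sub>R a + t *\<^sub>R b) - ga (x + \<xi> *\<^sub>R a) = t * gab (x + \<xi> *\<^sub>R a + \<eta> *\<^sub>R b)"
    using MVT2[OF t, of "\<lambda>s. ga (x + \<xi> *\<^sub>R a + s *\<^sub>R b)" "\<lambda>s. gab (x + \<xi> *\<^sub>R a + s *\<^sub>R b)"]
      directional_DERIV_shift[OF ab] by auto
  have "ga (x + t *\<^sub>R b + \<xi> *\<^sub>R a) = ga (x + \<xi> *\<^sub>R a + t *\<^sub>R b)"
    "g (x + t *\<^sub>R b + t *\<^sub>R a) = g (x + t *\<^sub>R a + t *\<^sub>R b)" by (simp_all add: ac_simps)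
  with \<xi> \<eta> show ?thesis by (intro exI[of _ \<xi>] exI[of _ \<eta>]) auto
qed

text \<open>
  The second difference is symmetric in the two directions, and each of the mixed derivatives,
  evaluated near the point, equals its quotient by the square of the step.
\<close>

lemma directional_Schwarz:
  fixes g :: "'a::real_normed_vector \<Rightarrow> real"
  assumes a: "\<And>y. ((\<lambda>s. g (y + s *\<^sub>R a)) has_real_derivative ga y) (at 0)"
    and b: "\<And>y. ((\<lambda>s. g (y + s *\<^sub>R b)) has_real_derivative gb y) (at 0)"
    and ab: "\<And>y. ((\<lambda>s. ga (y + s *\<^sub>R b)) has_real_derivative gab y) (at 0)"
    and ba: "\<And>y. ((\<lambda>s. gb (y + s *\<^sub>R a)) has_real_derivative gba y) (at 0)"
    and cont: "isCont gab x" "isCont gba x"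
  shows "gab x = gba x"
proof (rule dense_eq0_I[of "gab x - gba x", simplified])
  fix e :: real assume e: "0 < e"
  obtain d1 where d1: "d1 > 0" "\<And>y. dist y x < d1 \<Longrightarrow> dist (gab y) (gab x) < e / 2"
    using cont(1) e unfolding continuous_at_eps_delta by (meson half_gt_zero)
  obtain d2 where d2: "d2 > 0" "\<And>y. dist y x < d2 \<Longrightarrow> dist (gba y) (gba x) < e / 2"
    using cont(2) e unfolding continuous_at_eps_delta by (meson half_gt_zero)
  \<comment> \<open>Small enough that the whole parallelogram stays within the distances d1 and d2 of x.\<close>
  define t where "t = min d1 d2 / (norm a + norm b + 1)"
  have t: "0 < t" using d1(1) d2(1) by (simp add: t_def add_nonneg_pos)
  have near: "dist (x + p) x < min d1 d2" if "norm p \<le> t * norm a + t * norm b" for p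
  proof -
    have "norm p < t * (norm a + norm b + 1)" using that t by (simp add: algebra_simps)
    also have "\<dots> = min d1 d2" by (simp add: t_def add_nonneg_eq_0_iff)
    finally show ?thesis by (simp add: dist_norm)
  qed
  obtain p q where p: "0 \<le> p" "p \<le> t" "0 \<le> q" "q \<le> t"
    "g (x + t *\<^sub>R a + t *\<^sub>R b) - g (x + t *\<^sub>R a) - g (x + t *\<^sub>R b) + g x
      = t * t * gab (x + p *\<^sub>R a + q *\<^sub>R b)"
    using second_difference_mvt[OF a ab t] by blast
  obtain p' q' where p': "0 \<le> p'" "p' \<le> t" "0 \<le> q'" "q' \<le> t"
    "g (x + t *\<^sub>R b + t *\<^sub>R a) - g (x + t *\<^sub>R b) - g (x + t *\<^sub>R a) + g x
      = t * t * gba (x + p' *\<^sub>R b + q' *\<^sub>R a)"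
    using second_difference_mvt[OF b ba t] by blast
  have "t * t * gab (x + p *\<^sub>R a + q *\<^sub>R b) = t * t * gba (x + p' *\<^sub>R b + q' *\<^sub>R a)"
    unfolding p(5)[symmetric] p'(5)[symmetric] by (simp add: ac_simps)
  then have eq: "gab (x + p *\<^sub>R a + q *\<^sub>R b) = gba (x + p' *\<^sub>R b + q' *\<^sub>R a)" using t by simp
  have "norm (p *\<^sub>R a + q *\<^sub>R b) \<le> t * norm a + t * norm b"
    using p by (intro norm_triangle_le) (auto intro!: add_mono mult_right_mono)
  from near[OF this] have 1: "dist (gab (x + p *\<^sub>R a + q *\<^sub>R b)) (gab x) < e / 2"
    by (intro d1(2)) (simp add: add.assoc)
  have "norm (p' *\<^sub>R b + q' *\<^sub>R a) \<le> t * norm b + t * norm a"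
    using p' by (intro norm_triangle_le) (auto intro!: add_mono mult_right_mono)
  then have "dist (x + (p' *\<^sub>R b + q' *\<^sub>R a)) x < min d1 d2" by (intro near) simp
  then have 2: "dist (gba (x + p' *\<^sub>R b + q' *\<^sub>R a)) (gba x) < e / 2"
    by (intro d2(2)) (simp add: add.assoc)
  from 1 2 show "\<bar>gab x - gba x\<bar> \<le> e" unfolding eq dist_real_def by linarith
qed

section \<open>Uniqueness of directional gradients\<close>

text \<open>
  Limits of values at fixed tuples suffice both for the uniqueness of the gradient and for the
  derivatives of the jet that it defines.
\<close>

lemma has_R_higher_gradient_evaluate:
  assumes B: "has_R_higher_gradient_at R (Suc k) F x B" and F: "\<And>y. F y \<in> carr (multilin k whole whole)"
    and hs: "length hs = k"
  shows "((\<lambda>s. (F (x + s *\<^sub>R R v) hs - F x hs) /\<^sub>R s) \<longlongrightarrow> B (hs @ [v])) (at 0)"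
proof -
  let ?M = "multilin k (whole :: 'a nspace) (whole :: 'a nspace)"
  have Bc: "B \<in> carr (multilin (Suc k) whole whole)" using B by (simp add: has_R_higher_gradient_at_def)
  define \<Delta> where "\<Delta> s = (F (x + s *\<^sub>R R v) - F x) /\<^sub>R s - (\<lambda>hs. B (hs @ [v]))" for s
  have lim: "((\<lambda>s. nrm ?M (\<Delta> s)) \<longlongrightarrow> 0) (at 0)"
    using B by (simp add: has_R_higher_gradient_at_def \<Delta>_def)
  have slice: "(\<lambda>hs. B (hs @ [v])) \<in> carr ?M"
    by (rule multilin_slice(1)[OF normed_carrier_whole normed_carrier_whole Bc]) simp
  have \<Delta>c: "\<Delta> s \<in> carr ?M" for s
    unfolding \<Delta>_def
    by (intro normed_carrierD(3,4)[OF normed_carrier_multilin] normed_carrier_whole F slice)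
  have bd: "norm (\<Delta> s hs) \<le> nrm ?M (\<Delta> s) * prod_list (map norm hs)" for s
    using multilin_nrm_bound(2)[OF normed_carrier_whole normed_carrier_whole \<Delta>c, of hs] hs by simp
  have "((\<lambda>s. nrm ?M (\<Delta> s) * prod_list (map norm hs)) \<longlongrightarrow> 0) (at 0)"
    using tendsto_mult_left_zero[OF lim] .
  then have "((\<lambda>s. \<Delta> s hs) \<longlongrightarrow> 0) (at 0)"
    by (rule Lim_null_comparison[rotated]) (simp add: bd)
  moreover have "\<Delta> s hs = (F (x + s *\<^sub>R R v) hs - F x hs) /\<^sub>R s - B (hs @ [v])" for s
    by (simp add: \<Delta>_def scaleR_fun_def)
  ultimately show ?thesis by (simp add: LIM_zero_iff)
qed

lemma has_R_higher_gradient_unique: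
  assumes "has_R_higher_gradient_at R (Suc k) F x B" "has_R_higher_gradient_at R (Suc k) F x B'"
    and F: "\<And>y. F y \<in> carr (multilin k whole whole)"
  shows "B = B'"
proof
  fix hs
  show "B hs = B' hs"
  proof (cases "length hs = Suc k")
    case True
    then obtain gs v where h: "hs = gs @ [v]" "length gs = k" by (metis length_Suc_conv_rev)
    show ?thesis unfolding h(1)
      by (rule LIM_unique[OF has_R_higher_gradient_evaluate[OF assms(1) F h(2)]
            has_R_higher_gradient_evaluate[OF assms(2) F h(2)]])
  next
    case False
    then show ?thesis
      using assms multilinD(2)[of B "Suc k" whole whole hs] multilinD(2)[of B' "Suc k" whole whole hs]
      by (simp add: has_R_higher_gradient_at_def)
  qed
qed

lemma has_R_gradient_at_iff:
  "has_R_gradient_at R f x l \<longleftrightarrow>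
    (\<forall>v. ((\<lambda>s. f (x + s *\<^sub>R R v)) has_real_derivative inner l v) (at 0))"
  by (simp add: has_R_gradient_at_def directional_DERIV_iff tendsto_rabs_zero_iff LIM_zero_iff)

lemma has_R_gradient_unique:
  assumes "has_R_gradient_at R f x l" "has_R_gradient_at R f x l'"
  shows "l = l'"
proof -
  have "inner l v = inner l' v" for v
    using assms DERIV_unique unfolding has_R_gradient_at_iff by blast
  from this[of "l - l'"] have "inner (l - l') (l - l') = 0" by (simp only: inner_diff_left)
  then show ?thesis by simp
qed

lemma R_nabla_1:
  assumes "has_R_gradient_at R f x l"
  shows "R_nabla R (Suc 0) f x = (\<lambda>hs. if hs = [] then l else 0)"
proof -
  have "(THE l. has_R_gradient_at R f x l) = l"
    by (rule the_equality) (fact assms, rule has_R_gradient_unique[OF _ assms])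
  then show ?thesis by (simp add: fun_eq_iff)
qed

lemma R_nabla_SucI:
  assumes "has_R_higher_gradient_at R (Suc k) (R_nabla R (Suc k) f) x B"
    and "\<And>y. R_nabla R (Suc k) f y \<in> carr (multilin k whole whole)"
  shows "R_nabla R (Suc (Suc k)) f x = B"
    and "\<exists>!B. has_R_higher_gradient_at R (Suc k) (R_nabla R (Suc k) f) x B"
proof -
  note unique = has_R_higher_gradient_unique[OF _ assms]
  show "R_nabla R (Suc (Suc k)) f x = B"
    unfolding R_nabla.simps(3) by (rule the_equality) (fact assms(1), rule unique)
  show "\<exists>!B. has_R_higher_gradient_at R (Suc k) (R_nabla R (Suc k) f) x B"
    by (rule ex1I) (fact assms(1), rule unique)
qed

lemma R_nabla_Suc_works:
  assumes "R_times_differentiable_at R (Suc (Suc k)) f x"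
  shows "has_R_higher_gradient_at R (Suc k) (R_nabla R (Suc k) f) x (R_nabla R (Suc (Suc k)) f x)"
proof -
  have "\<exists>!B. has_R_higher_gradient_at R (Suc k) (R_nabla R (Suc k) f) x B"
    using assms unfolding R_times_differentiable_at.simps by blast
  from theI'[OF this] show ?thesis unfolding R_nabla.simps(3) .
qed

lemma R_times_differentiable_mono:
  assumes "\<forall>x. R_times_differentiable_at R n f x" "k \<le> n"
  shows "\<forall>x. R_times_differentiable_at R k f x"
  using assms(2,1)
proof (induction n rule: dec_induct)
  case (step n)
  then show ?case by (cases n) (auto simp del: R_nabla.simps)
qed simp

section \<open>Jets along the range\<close>

context bounded_operator
begin

text \<open>
  The order of a form is an explicit index, so that all forms of one order are bundled into a map into
  the space of multilinear forms.
\<close>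

definition jet :: "nat \<Rightarrow> ('a \<Rightarrow> real) \<Rightarrow> (nat \<Rightarrow> 'a \<Rightarrow> 'a list \<Rightarrow> real) \<Rightarrow> bool"
  where "jet n f D \<longleftrightarrow> (\<forall>x. D 0 x [] = f x) \<and>
    (\<forall>vs v x. length vs < n \<longrightarrow> ((\<lambda>s. D (length vs) (x + s *\<^sub>R R v) vs)
       has_real_derivative D (Suc (length vs)) x (vs @ [v])) (at 0)) \<and>
    (\<forall>k\<le>n. D k \<in> BUC (multilin k whole whole))"

lemma jetD:
  assumes "jet n f D"
  shows "D 0 x [] = f x"
    and "length vs < n \<Longrightarrow> ((\<lambda>s. D (length vs) (x + s *\<^sub>R R v) vs)
       has_real_derivative D (Suc (length vs)) x (vs @ [v])) (at 0)"
    and "k \<le> n \<Longrightarrow> D k \<in> BUC (multilin k whole whole)"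
    and "k \<le> n \<Longrightarrow> D k x \<in> carr (multilin k whole whole)"
proof -
  note a = assms[unfolded jet_def]
  show "D 0 x [] = f x" using a by simp
  show "((\<lambda>s. D (length vs) (x + s *\<^sub>R R v) vs)
      has_real_derivative D (Suc (length vs)) x (vs @ [v])) (at 0)" if "length vs < n"
    using a[THEN conjunct2, THEN conjunct1, rule_format, OF that] .
  show B: "D k \<in> BUC (multilin k whole whole)" if "k \<le> n"
    using a[THEN conjunct2, THEN conjunct2, rule_format, OF that] .
  show "D k x \<in> carr (multilin k whole whole)" if "k \<le> n"
    using BUC_D(1)[OF B[OF that]] .
qed

lemma jet_uniform:
  assumes D: "jet n f D" and "k \<le> n" and "0 < \<epsilon>"
  shows "\<exists>\<delta>>0. \<forall>x y vs. dist x y < \<delta> \<longrightarrow> length vs = k \<longrightarrow>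
    \<bar>D k x vs - D k y vs\<bar> \<le> \<epsilon> * prod_list (map norm vs)"
proof -
  let ?M = "multilin k (whole :: 'a nspace) (whole :: real nspace)"
  obtain d where d: "d > 0" "\<And>x y. dist x y < d \<Longrightarrow> nrm ?M (D k x - D k y) < \<epsilon>"
    using BUC_D(3)[OF jetD(3)[OF D \<open>k \<le> n\<close>] \<open>0 < \<epsilon>\<close>] by blast
  show ?thesis
  proof (intro exI[of _ d] conjI allI impI)
    fix x y :: 'a and vs :: "'a list"
    assume xy: "dist x y < d" and vs: "length vs = k"
    have c: "D k x - D k y \<in> carr ?M"
      by (intro normed_carrierD(3) normed_carrier_multilin normed_carrier_whole jetD(4)[OF D \<open>k \<le> n\<close>])
    have "\<bar>D k x vs - D k y vs\<bar> \<le> nrm ?M (D k x - D k y) * prod_list (map norm vs)"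
      using multilin_nrm_bound(2)[OF normed_carrier_whole normed_carrier_whole c, of vs] vs by simp
    also have "\<dots> \<le> \<epsilon> * prod_list (map norm vs)"
      using d(2)[OF xy] by (intro mult_right_mono prod_list_norm_nonneg) auto
    finally show "\<bar>D k x vs - D k y vs\<bar> \<le> \<epsilon> * prod_list (map norm vs)" .
  qed (use d in simp)
qed

lemma jet_isCont:
  assumes D: "jet n f D" and k: "length vs \<le> n"
  shows "isCont (\<lambda>x. D (length vs) x vs) x"
  unfolding continuous_at_eps_delta
proof (intro allI impI)
  fix e :: real assume e: "0 < e"
  let ?P = "prod_list (map norm vs) + 1"
  have P: "0 < ?P" using prod_list_norm_nonneg[of vs] by simp
  then obtain d where d: "d > 0" "\<And>x y. dist x y < d \<Longrightarrow>
      \<bar>D (length vs) x vs - D (length vs) y vs\<bar> \<le> e / ?P * prod_list (map norm vs)"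
    using jet_uniform[OF D k, of "e / ?P"] e by (metis divide_pos_pos)
  have "e / ?P * prod_list (map norm vs) < e" using e P by (simp add: field_simps)
  then show "\<exists>d>0. \<forall>x'. dist x' x < d \<longrightarrow> dist (D (length vs) x' vs) (D (length vs) x vs) < e"
    using d by (intro exI[of _ d]) (auto simp: dist_real_def intro: le_less_trans)
qed

lemma jet_symmetric:
  assumes D: "jet n f D" and k: "Suc (length vs) < n"
  shows "D (Suc (Suc (length vs))) x (vs @ [a, b]) = D (Suc (Suc (length vs))) x (vs @ [b, a])"
proof -
  have 1: "((\<lambda>s. D (length vs) (y + s *\<^sub>R R a) vs)
      has_real_derivative D (Suc (length vs)) y (vs @ [a])) (at 0)" for y a
    using jetD(2)[OF D] k by simp
  have 2: "((\<lambda>s. D (Suc (length vs)) (y + s *\<^sub>R R b) (vs @ [a]))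
      has_real_derivative D (Suc (Suc (length vs))) y (vs @ [a, b])) (at 0)" for y a b
    using jetD(2)[OF D, of "vs @ [a]"] k by simp
  have 3: "isCont (\<lambda>y. D (Suc (Suc (length vs))) y (vs @ [a, b])) x" for a b
    using jet_isCont[OF D, of "vs @ [a, b]"] k by simp
  show ?thesis by (rule directional_Schwarz[OF 1 1 2 2 3 3])
qed

text \<open>
  The linearisation error is the variation of the next form between \<open>x\<close> and a point on the
  segment to \<open>x + R v\<close>; uniform continuity makes it small uniformly in the base point and the
  arguments, which yields Frechet differentiability as well as norm convergence of difference
  quotients.
\<close>

lemma jet_mean_value:
  assumes D: "jet n f D" and k: "k < n" and "0 < \<epsilon>"
  shows "\<exists>\<delta>>0. \<forall>x vs v. norm (R v) < \<delta> \<longrightarrow> length vs = k \<longrightarrow>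
    \<bar>D k (x + R v) vs - D k x vs - D (Suc k) x (vs @ [v])\<bar> \<le> \<epsilon> * (prod_list (map norm vs) * norm v)"
proof -
  obtain d where d: "d > 0" "\<And>x y vs. dist x y < d \<Longrightarrow> length vs = Suc k \<Longrightarrow>
      \<bar>D (Suc k) x vs - D (Suc k) y vs\<bar> \<le> \<epsilon> * prod_list (map norm vs)"
    using jet_uniform[OF D _ \<open>0 < \<epsilon>\<close>, of "Suc k"] k by (metis Suc_leI)
  show ?thesis
  proof (intro exI[of _ d] conjI allI impI)
    fix x v and vs :: "'a list"
    assume v: "norm (R v) < d" and vs: "length vs = k"
    have "((\<lambda>s. D k (y + s *\<^sub>R R v) vs) has_real_derivative D (Suc k) y (vs @ [v])) (at 0)" for y
      using jetD(2)[OF D, of vs] vs k by simp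
    from directional_mvt[OF this, of x] obtain z where z: "0 \<le> z" "z \<le> 1"
      "D k (x + R v) vs - D k x vs = D (Suc k) (x + z *\<^sub>R R v) (vs @ [v])" by blast
    have "z * norm (R v) \<le> 1 * norm (R v)" using z by (intro mult_right_mono) auto
    then have "dist (x + z *\<^sub>R R v) x < d" using v z by (simp add: dist_norm)
    from d(2)[OF this, of "vs @ [v]"] vs
    show "\<bar>D k (x + R v) vs - D k x vs - D (Suc k) x (vs @ [v])\<bar> \<le> \<epsilon> * (prod_list (map norm vs) * norm v)"
      by (simp add: z(3))
  qed (use d in simp)
qed

lemma jet_0:
  assumes "jet n f D"
  shows "f \<in> BUC whole"
proof -
  have "D 0 x = (\<lambda>vs. if vs = [] then f x else 0)" for x
    using jetD(1)[OF assms] multilinD(2)[OF jetD(4)[OF assms, of 0]] by (auto simp: fun_eq_iff)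
  then show ?thesis using BUC_multilin_0_iff[of "D 0" f] jetD(3)[OF assms, of 0] by simp
qed

section \<open>Jets and Frechet derivatives\<close>

lemma contraction_R: "contraction whole (HR R) R"
  using R by (auto simp: contraction_def norm_pinv_R_le linear_simps)

lemma contraction_pinv: "contraction (HR R) whole (pinv R)"
  by (auto simp: contraction_def pinv_add pinv_scaleR)

text \<open>
  Pull the derivatives back along \<open>R\<close>.  Order \<open>0\<close> is treated separately because \<open>HR_Dk\<close> is
  undefined there.
\<close>

lemma jet_of_BUC_HR:
  assumes f: "f \<in> BUC_HR R n"
  shows "\<exists>D. jet n f D"
proof -
  define D :: "nat \<Rightarrow> 'a \<Rightarrow> 'a list \<Rightarrow> real" where "D k x = (if k = 0 then \<lambda>vs. if vs = [] then f x else 0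
      else pullback whole k R (HR_Dk R whole k f x))" for k x
  have diff: "HR_times_differentiable R whole k f" if "k \<le> n" for k
    using f that HR_times_differentiable_mono by (auto simp: BUC_HR_def)
  have Dk: "HR_Dk R whole (Suc m) f x \<in> carr (multilin (Suc m) (HR R) whole)" if "Suc m \<le> n" for m x
    by (rule HR_Dk_carr[OF diff[OF that]])
  have D_Suc: "D (Suc (length vs)) x (vs @ [v]) = HR_Dk R whole (Suc (length vs)) f x (map R vs @ [R v])" for x vs v
    by (simp add: D_def pullback_def restrict_tuples_def)
  have "jet n f D"
    unfolding jet_def
  proof (intro conjI allI impI)
    show "D 0 x [] = f x" for x by (simp add: D_def)
    show "((\<lambda>s. D (length vs) (x + s *\<^sub>R R v) vs) has_real_derivative
        D (Suc (length vs)) x (vs @ [v])) (at 0)" if k: "length vs < n" for vs v x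
    proof (cases vs rule: rev_cases)
      case Nil
      have "has_HR_derivative_at R whole f x (HR_Dk R whole (Suc 0) f x)"
        using diff[of "Suc 0"] k Nil by (auto intro: HR_D_works)
      from has_HR_derivative_directional[OF this, of "R v"] show ?thesis
        by (simp add: Nil D_def pullback_def restrict_tuples_def)
    next
      case (snoc us u)
      have "map R vs \<in> tuples (HR R) (Suc (length us))"
        by (rule map_R_tuples) (simp add: snoc)
      moreover have "HR_times_differentiable R (whole :: real nspace) (Suc (Suc (length us))) f"
        using k snoc by (intro diff) simp
      ultimately have "((\<lambda>s. HR_Dk R whole (Suc (length us)) f (x + s *\<^sub>R R v) (map R vs)) has_real_derivative
          HR_Dk R whole (Suc (Suc (length us))) f x (map R vs @ [R v])) (at 0)"
        by (intro HR_Dk_directional) auto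
      moreover have "D (length vs) y vs = HR_Dk R whole (Suc (length us)) f y (map R vs)" for y
        using D_Suc[of us y u] by (simp add: snoc)
      ultimately show ?thesis by (simp only: D_Suc) (simp add: snoc)
    qed
    show "D k \<in> BUC (multilin k whole whole)" if k: "k \<le> n" for k
    proof (cases k)
      case 0
      have "D 0 \<in> BUC (multilin 0 whole whole)"
        using f by (subst BUC_multilin_0_iff[of _ f]) (auto simp: D_def BUC_HR_def)
      then show ?thesis using 0 by simp
    next
      case (Suc m)
      have "HR_nabla R (Suc m) f \<in> BUC (multilin m (HR R) (HR R))"
      proof -
        have "\<forall>i \<in> {1..n}. HR_nabla R i f \<in> BUC (multilin (i - 1) (HR R) (HR R))"
          using f by (simp add: BUC_HR_def)
        from this[rule_format, of "Suc m"] k Suc show ?thesis by simp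
      qed
      then have "HR_Dk R whole (Suc m) f \<in> BUC (multilin (Suc m) (HR R) whole)"
        using BUC_HR_nabla_iff[OF Dk, of m] k Suc by simp
      from BUC_pullback[OF normed_carrier_whole normed_carrier_HR normed_carrier_whole contraction_R this]
      show ?thesis by (simp add: D_def[abs_def] Suc)
    qed
  qed
  then show ?thesis by blast
qed

text \<open>
  The mean value estimate with \<open>v = pinv R h\<close>, whose norm is that of \<open>h\<close> in \<open>H\<^sub>R\<close>.
\<close>

lemma jet_has_HR_derivative:
  assumes D: "jet n f D" and k: "k < n"
  shows "has_HR_derivative_at R (multilin k (HR R) whole) (\<lambda>y. pullback (HR R) k (pinv R) (D k y)) x
    (\<lambda>l. if l \<in> tuples (HR R) 1 then (\<lambda>hs. pullback (HR R) (Suc k) (pinv R) (D (Suc k) x) (hs @ l)) else 0)"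
    (is "has_HR_derivative_at R ?M ?E x ?L")
proof (rule has_HR_derivative_atI)
  have "pullback (HR R) (Suc k) (pinv R) (D (Suc k) x) \<in> carr (multilin (Suc k) (HR R) whole)"
    using k by (intro pullback_multilin(1)[OF normed_carrier_HR normed_carrier_whole
          normed_carrier_whole contraction_pinv] jetD(4)[OF D]) simp
  then show "?L \<in> carr (multilin 1 (HR R) ?M)"
    by (rule multilin_curry[OF normed_carrier_HR normed_carrier_whole])
  fix e :: real assume e: "0 < e"
  obtain d where d: "d > 0" "\<And>x vs v. norm (R v) < d \<Longrightarrow> length vs = k \<Longrightarrow>
    \<bar>D k (x + R v) vs - D k x vs - D (Suc k) x (vs @ [v])\<bar> \<le> e * (prod_list (map norm vs) * norm v)"
    using jet_mean_value[OF D k e] by blast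
  obtain B where B: "B > 0" "\<And>v. norm (R v) \<le> norm v * B"
    using bounded_linear.pos_bounded[OF R] by blast
  show "\<exists>d>0. \<forall>h\<in>range R. norm (pinv R h) < d \<longrightarrow>
      nrm ?M (?E (x + h) - ?E x - ?L [h]) \<le> e * norm (pinv R h)"
  \<comment> \<open>The radius in H, divided by the norm bound of R, is a radius in the norm of the range.\<close>
  proof (intro exI[of _ "d / B"] conjI ballI impI)
    show "0 < d / B" using d B by simp
    fix h assume h: "h \<in> range R" "norm (pinv R h) < d / B"
    have Rh: "R (pinv R h) = h" by (rule pinv_range(2)[OF h(1)])
    have "norm (R (pinv R h)) \<le> norm (pinv R h) * B" by (rule B)
    also have "\<dots> < d" using h(2) B(1) by (simp add: field_simps)
    finally have small: "norm (R (pinv R h)) < d" .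
    show "nrm ?M (?E (x + h) - ?E x - ?L [h]) \<le> e * norm (pinv R h)"
    proof (rule multilin_nrm_le[OF normed_carrier_HR])
      show "0 \<le> e * norm (pinv R h)" using e by simp
      fix hs assume hs: "hs \<in> tuples (HR R) k"
      let ?vs = "map (pinv R) hs"
      have len: "length ?vs = k" using hs by (simp add: tuples_def)
      have t: "hs @ [h] \<in> tuples (HR R) (Suc k)" "[h] \<in> tuples (HR R) 1"
        using hs h(1) by (auto simp: tuples_def)
      have "(?E (x + h) - ?E x - ?L [h]) hs = D k (x + h) ?vs - D k x ?vs - D (Suc k) x (?vs @ [pinv R h])"
        using hs t by (simp add: pullback_def restrict_tuples_def)
      moreover have "\<bar>D k (x + h) ?vs - D k x ?vs - D (Suc k) x (?vs @ [pinv R h])\<bar>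
          \<le> e * (prod_list (map norm ?vs) * norm (pinv R h))"
        using d(2)[OF small len, of x] unfolding Rh .
      moreover have "map norm ?vs = map (nrm (HR R)) hs" by simp
      ultimately show "nrm whole ((?E (x + h) - ?E x - ?L [h]) hs)
          \<le> e * norm (pinv R h) * prod_list (map (nrm (HR R)) hs)"
        by (simp only: whole_simps real_norm_def mult_ac)
    qed
  qed
qed

text \<open>
  Both the differentiability and the value are obtained at once, since the next order
  differentiates the derivative that the previous order has identified.
\<close>

lemma jet_HR_Dk:
  assumes D: "jet n f D" and k: "Suc k \<le> n"
  shows "HR_times_differentiable R whole (Suc k) f \<and>
    (\<forall>x. HR_Dk R whole (Suc k) f x = pullback (HR R) (Suc k) (pinv R) (D (Suc k) x))"
  using k
proof (induction k)
  let ?E = "\<lambda>k y. pullback (HR R) k (pinv R) (D k y)"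
  have Ec: "?E k y \<in> carr (multilin k (HR R) whole)" if "k \<le> n" for k y
    by (intro pullback_multilin(1)[OF normed_carrier_HR normed_carrier_whole
          normed_carrier_whole contraction_pinv] jetD(4)[OF D that])
  have evaluate: "has_HR_derivative_at R whole (\<lambda>y. ?E k y gs) x
      (\<lambda>l. if l \<in> tuples (HR R) 1 then ?E (Suc k) x (gs @ l) else 0)"
    if "Suc k \<le> n" "gs \<in> tuples (HR R) k" for k x gs
  proof -
    have "(\<lambda>l. (if l \<in> tuples (HR R) 1 then (\<lambda>hs. ?E (Suc k) x (hs @ l)) else 0) gs)
      = (\<lambda>l. if l \<in> tuples (HR R) 1 then ?E (Suc k) x (gs @ l) else 0)" by auto
    from back_subst[of "has_HR_derivative_at R whole (\<lambda>y. ?E k y gs) x", OF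
        has_HR_derivative_evaluate[OF normed_carrier_whole Ec jet_has_HR_derivative[OF D] that(2)] this]
      that(1)
    show ?thesis by simp
  qed
  {
    case 0
    have "has_HR_derivative_at R whole f x (?E (Suc 0) x)" for x
    proof -
      have "(\<lambda>l. if l \<in> tuples (HR R) 1 then ?E (Suc 0) x ([] @ l) else 0) = ?E (Suc 0) x"
        by (auto simp: pullback_def restrict_tuples_def)
      moreover have "(\<lambda>y. ?E 0 y []) = f"
        by (simp add: fun_eq_iff pullback_def restrict_tuples_def tuples_0 jetD(1)[OF D])
      ultimately show ?thesis using evaluate[of 0 "[]" x] 0 by (simp add: tuples_0)
    qed
    from HR_D_eq[OF normed_carrier_whole _ this] show ?case
      unfolding HR_times_differentiable.simps HR_Dk.simps by (intro conjI allI) simp_all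
  next
    case (Suc k)
    have Dk: "HR_Dk R whole (Suc k) f = (\<lambda>y. ?E (Suc k) y)"
      and diff: "HR_times_differentiable R (whole :: real nspace) (Suc k) f"
      using Suc by (auto simp: fun_eq_iff)
    have "HR_Dk R whole (Suc (Suc k)) f x hs = ?E (Suc (Suc k)) x hs" for x hs
    proof (cases "hs \<in> tuples (HR R) (Suc (Suc k))")
      case True
      then obtain gs h where h: "hs = gs @ [h]" "gs \<in> tuples (HR R) (Suc k)" "h \<in> carr (HR R)"
        by (rule tuples_Suc_snocE)
      from HR_D_eq(1)[OF normed_carrier_whole _ evaluate[OF Suc.prems h(2)], of x] True h
      show ?thesis by (simp add: Dk tuples_1)
    qed (simp add: pullback_def restrict_tuples_def)
    moreover have "HR_differentiable_at R (multilin (Suc k) (HR R) whole) (HR_Dk R whole (Suc k) f) x" for x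
      unfolding Dk using Suc.prems
      by (intro HR_D_eq(2)[OF normed_carrier_multilin[OF normed_carrier_HR normed_carrier_whole]
            Ec jet_has_HR_derivative[OF D]]) auto
    ultimately show ?case
      using diff unfolding HR_times_differentiable.simps by (intro conjI allI ext)
  }
qed

lemma jet_imp_BUC_HR:
  assumes D: "jet n f D"
  shows "f \<in> BUC_HR R n"
    and "Suc m \<le> n \<Longrightarrow>
      represents m (pullback (HR R) (Suc m) (pinv R) (D (Suc m) x)) (HR_nabla R (Suc m) f x)"
proof -
  have Dk: "HR_Dk R whole (Suc m) f = (\<lambda>x. pullback (HR R) (Suc m) (pinv R) (D (Suc m) x))"
    if "Suc m \<le> n" for m
    using jet_HR_Dk[OF D that] by (simp add: fun_eq_iff)
  have B: "HR_Dk R whole (Suc m) f \<in> BUC (multilin (Suc m) (HR R) whole)" if "Suc m \<le> n" for m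
    unfolding Dk[OF that]
    by (intro BUC_pullback[OF normed_carrier_HR normed_carrier_whole normed_carrier_whole
          contraction_pinv] jetD(3)[OF D that])
  have rep: "represents m (HR_Dk R whole (Suc m) f x) (HR_nabla R (Suc m) f x)" if "Suc m \<le> n" for m x
    using represents_HR_nabla_iff[OF BUC_D(1)[OF B[OF that]]] by blast
  show "represents m (pullback (HR R) (Suc m) (pinv R) (D (Suc m) x)) (HR_nabla R (Suc m) f x)"
    if "Suc m \<le> n" using rep[OF that] unfolding Dk[OF that] .
  have "HR_nabla R i f \<in> BUC (multilin (i - 1) (HR R) (HR R))" if i: "i \<in> {1..n}" for i
  proof -
    obtain m where m: "i = Suc m" "Suc m \<le> n" using i by (cases i) auto
    show ?thesis
      using BUC_HR_nabla_iff[OF BUC_D(1)[OF B[OF m(2)]]] B[OF m(2)] m(1) by simp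
  qed
  moreover have "HR_times_differentiable R (whole :: real nspace) n f"
    using jet_HR_Dk[OF D] by (cases n) auto
  ultimately show "f \<in> BUC_HR R n" using jet_0[OF D] by (simp add: BUC_HR_def)
qed

section \<open>Jets and directional gradients\<close>

text \<open>
  The pairing with the gradient of order 1 differentiates first and occupies the first slot for ever
  after; later differentiations append their directions on the right.
\<close>

lemma jet_of_BUC_R:
  assumes f: "f \<in> BUC_R R n"
  shows "\<exists>D. jet n f D"
proof -
  define D :: "nat \<Rightarrow> 'a \<Rightarrow> 'a list \<Rightarrow> real" where "D k x = (case k of 0 \<Rightarrow> \<lambda>vs. if vs = [] then f x else 0
      | Suc m \<Rightarrow> prepend m (R_nabla R (Suc m) f x))" for k x
  have diff: "R_times_differentiable_at R k f x" if "k \<le> n" for k x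
    using f that R_times_differentiable_mono[of R n f k] by (auto simp: BUC_R_def)
  have B: "R_nabla R (Suc m) f \<in> BUC (multilin m whole whole)" if "Suc m \<le> n" for m
  proof -
    have "\<forall>i \<in> {1..n}. R_nabla R i f \<in> BUC (multilin (i - 1) whole whole)"
      using f by (simp add: BUC_R_def)
    from this[rule_format, of "Suc m"] that show ?thesis by simp
  qed
  have "jet n f D"
    unfolding jet_def
  proof (intro conjI allI impI)
    show "D 0 x [] = f x" for x by (simp add: D_def)
    show "((\<lambda>s. D (length vs) (x + s *\<^sub>R R v) vs) has_real_derivative
        D (Suc (length vs)) x (vs @ [v])) (at 0)" if k: "length vs < n" for vs v x
    proof (cases vs)
      case Nil
      obtain l where l: "has_R_gradient_at R f x l" using diff[of "Suc 0" x] k Nil by auto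
      then show ?thesis
        unfolding has_R_gradient_at_iff by (simp add: Nil D_def prepend_def R_nabla_1[OF l] del: R_nabla.simps)
    next
      case (Cons w us)
      let ?F = "R_nabla R (Suc (length us)) f"
      have d: "has_R_higher_gradient_at R (Suc (length us)) ?F x (R_nabla R (Suc (Suc (length us))) f x)"
        using k Cons by (intro R_nabla_Suc_works diff) simp
      have Fc: "?F y \<in> carr (multilin (length us) whole whole)" for y
        using k Cons by (intro BUC_D(1)[OF B]) simp
      have "((\<lambda>s. inner ((?F (x + s *\<^sub>R R v) us - ?F x us) /\<^sub>R s) w)
          \<longlongrightarrow> inner (R_nabla R (Suc (Suc (length us))) f x (us @ [v])) w) (at 0)"
        by (intro tendsto_intros has_R_higher_gradient_evaluate[OF d Fc]) simp
      moreover have "inner ((?F (x + s *\<^sub>R R v) us - ?F x us) /\<^sub>R s) w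
          = (D (length vs) (x + s *\<^sub>R R v) vs - D (length vs) x vs) / s" for s
        by (simp add: Cons D_def prepend_def inner_diff_left divide_inverse mult.commute del: R_nabla.simps)
      moreover have "inner (R_nabla R (Suc (Suc (length us))) f x (us @ [v])) w
          = D (Suc (length vs)) x (vs @ [v])"
        by (simp add: Cons D_def prepend_def del: R_nabla.simps)
      ultimately show ?thesis
        unfolding directional_DERIV_iff[of "\<lambda>y. D (length vs) y vs"] by simp
    qed
    show "D k \<in> BUC (multilin k whole whole)" if k: "k \<le> n" for k
    proof (cases k)
      case 0
      have "D 0 \<in> BUC (multilin 0 whole whole)"
        using f by (subst BUC_multilin_0_iff[of _ f]) (auto simp: D_def BUC_R_def)
      then show ?thesis using 0 by simp
    next
      case (Suc m)
      have "D k = (\<lambda>x. prepend m (R_nabla R (Suc m) f x))"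
        by (simp add: D_def[abs_def] Suc del: R_nabla.simps)
      then show ?thesis using BUC_prepend[OF B, of m] k Suc by simp
    qed
  qed
  then show ?thesis by blast
qed

text \<open>
  The gradient represents in the slot of the last differentiation, so the direction \<open>v\<close> of a new
  differentiation is appended behind the tested vector \<open>w\<close>, while the gradient of the next order has
  \<open>v\<close> before \<open>w\<close>.  The symmetry of the jet reconciles the two; the norm of the difference is
  then that of a form to which the mean value estimate applies.
\<close>

lemma jet_has_R_higher_gradient:
  assumes D: "jet n f D" and k: "Suc k < n"
    and G: "\<And>y. gradient_of k (D (Suc k) y) (G y)" and G': "gradient_of (Suc k) (D (Suc (Suc k)) x) G'"
  shows "has_R_higher_gradient_at R (Suc k) G x G'"
  unfolding has_R_higher_gradient_at_def
proof (intro conjI allI)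
  let ?M = "multilin (Suc k) (whole :: 'a nspace) (whole :: real nspace)"
  show "G' \<in> carr (multilin (Suc k) whole whole)" by (rule gradient_of_carr[OF G'])
  fix v
  define \<Delta> where "\<Delta> s = (G (x + s *\<^sub>R R v) - G x) /\<^sub>R s - (\<lambda>hs. G' (hs @ [v]))" for s
  define \<Lambda> where "\<Lambda> s = (D (Suc k) (x + s *\<^sub>R R v) - D (Suc k) x) /\<^sub>R s
      - (\<lambda>hs. D (Suc (Suc k)) x (hs @ [v]))" for s
  have slice: "(\<lambda>hs. D (Suc (Suc k)) x (hs @ [v])) \<in> carr ?M"
    using k by (intro multilin_slice(1)[OF normed_carrier_whole normed_carrier_whole] jetD(4)[OF D]) auto
  have "\<Lambda> s \<in> carr ?M" for s
    unfolding \<Lambda>_def using k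
    by (intro normed_carrierD(3,4)[OF normed_carrier_multilin] normed_carrier_whole slice jetD(4)[OF D]) auto
  then have le: "nrm (multilin k whole whole) (\<Delta> s) \<le> nrm ?M (\<Lambda> s)" for s
  proof (rule gradient_nrm_le)
    show "\<Delta> s hs \<in> range (\<lambda>x. x)" for hs by simp
    show "\<Delta> s hs = 0" if "hs \<notin> tuples whole k" for hs
      using that multilinD(2)[OF gradient_of_carr[OF G]] multilinD(2)[OF gradient_of_carr[OF G']]
      by (simp add: \<Delta>_def scaleR_fun_def)
    show "inner (\<Delta> s hs) w = \<Lambda> s (hs @ [w])" if hs: "hs \<in> tuples whole k" for hs w
    proof -
      \<comment> \<open>The only place where differentiations are exchanged.\<close>
      have "D (Suc (Suc k)) x (hs @ [v, w]) = D (Suc (Suc k)) x (hs @ [w, v])"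
        using jet_symmetric[OF D, of hs] k hs by simp
      then show ?thesis
        using hs gradient_of_inner[OF G] gradient_of_inner[OF G']
        by (simp add: \<Delta>_def \<Lambda>_def scaleR_fun_def inner_diff_left)
    qed
  qed
  have nonneg: "0 \<le> nrm (multilin k whole whole) (\<Delta> s)" for s
  proof (rule multilin_nrm_bound(1)[OF normed_carrier_whole normed_carrier_whole])
    show "\<Delta> s \<in> carr (multilin k whole whole)"
      unfolding \<Delta>_def
      by (intro normed_carrierD(3,4)[OF normed_carrier_multilin] normed_carrier_whole
          gradient_of_carr[OF G] multilin_slice(1) gradient_of_carr[OF G']) simp
  qed
  have "((\<lambda>s. nrm (multilin k whole whole) (\<Delta> s)) \<longlongrightarrow> 0) (at 0)"
  proof (rule LIM_I)
    fix e :: real assume e: "0 < e"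
    \<comment> \<open>The estimate carries a factor norm v, which may vanish.\<close>
    define e' where "e' = e / (2 * (norm v + 1))"
    have e': "0 < e'" using e by (simp add: e'_def add_nonneg_pos)
    obtain d where d: "d > 0" "\<And>x vs v. norm (R v) < d \<Longrightarrow> length vs = Suc k \<Longrightarrow>
        \<bar>D (Suc k) (x + R v) vs - D (Suc k) x vs - D (Suc (Suc k)) x (vs @ [v])\<bar>
          \<le> e' * (prod_list (map norm vs) * norm v)"
      using jet_mean_value[OF D k e'] by blast
    let ?r = "d / (norm (R v) + 1)"
    show "\<exists>r>0. \<forall>s. s \<noteq> 0 \<and> norm (s - 0) < r \<longrightarrow> norm (nrm (multilin k whole whole) (\<Delta> s) - 0) < e"
    proof (intro exI[of _ ?r] conjI allI impI)
      show "0 < ?r" using d by (simp add: add_nonneg_pos)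
      fix s :: real assume s: "s \<noteq> 0 \<and> norm (s - 0) < ?r"
      have "\<bar>s\<bar> * norm (R v) \<le> \<bar>s\<bar> * (norm (R v) + 1)" by (intro mult_left_mono) auto
      also have "\<dots> < d" using s by (simp add: less_divide_eq add_nonneg_pos)
      finally have small: "norm (R (s *\<^sub>R v)) < d" using R by (simp add: linear_simps)
      have "nrm ?M (\<Lambda> s) \<le> e' * norm v"
      proof (rule multilin_nrm_le[OF normed_carrier_whole])
        show "0 \<le> e' * norm v" using e' by simp
        fix vs :: "'a list" assume "vs \<in> tuples whole (Suc k)"
        then have vs: "length vs = Suc k" by simp
        have "vs @ v # [] \<in> tuples whole (Suc (Suc k))" using vs by simp
        from multilinear_on_scaleR[OF multilinD(3)[OF jetD(4)[OF D, where x = x]] this, of s] k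
        have "D (Suc (Suc k)) x (vs @ [s *\<^sub>R v]) = s * D (Suc (Suc k)) x (vs @ [v])" by simp
        then have "\<bar>D (Suc k) (x + s *\<^sub>R R v) vs - D (Suc k) x vs - s * D (Suc (Suc k)) x (vs @ [v])\<bar>
            \<le> e' * (prod_list (map norm vs) * (\<bar>s\<bar> * norm v))"
          using d(2)[OF small vs, of x] R by (simp add: linear_simps)
        moreover have "\<Lambda> s vs = (D (Suc k) (x + s *\<^sub>R R v) vs - D (Suc k) x vs - s * D (Suc (Suc k)) x (vs @ [v])) / s"
          using s by (simp add: \<Lambda>_def scaleR_fun_def field_simps)
        ultimately show "nrm whole (\<Lambda> s vs) \<le> e' * norm v * prod_list (map (nrm whole) vs)"
          using s by (simp add: abs_divide divide_le_eq mult_ac)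
      qed
      also have "\<dots> \<le> e' * (norm v + 1)" using e' by (intro mult_left_mono) auto
      also have "\<dots> = e / 2" by (simp add: e'_def field_simps add_nonneg_eq_0_iff)
      also have "\<dots> < e" using e by simp
      finally have "nrm ?M (\<Lambda> s) < e" .
      then show "norm (nrm (multilin k whole whole) (\<Delta> s) - 0) < e"
        using le[of s] nonneg[of s] by simp
    qed
  qed
  then show "((\<lambda>s. nrm (multilin (Suc k - 1) whole whole)
      ((G (x + s *\<^sub>R R v) - G x) /\<^sub>R s - (\<lambda>hs. G' (hs @ [v])))) \<longlongrightarrow> 0) (at 0)"
    by (simp add: \<Delta>_def)
qed

lemma jet_R_nabla:
  assumes D: "jet n f D" and k: "Suc k \<le> n"
  shows "(\<forall>x. R_times_differentiable_at R (Suc k) f x) \<and>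
    (\<forall>x. gradient_of k (D (Suc k) x) (R_nabla R (Suc k) f x))"
  using k
proof (induction k)
  case 0
  have "R_times_differentiable_at R (Suc 0) f x \<and> gradient_of 0 (D (Suc 0) x) (R_nabla R (Suc 0) f x)" for x
  proof -
    obtain G where G: "gradient_of 0 (D (Suc 0) x) G"
      using gradient_of_exists[OF jetD(4)[OF D 0]] by blast
    have "has_R_gradient_at R f x (G [])"
      unfolding has_R_gradient_at_iff using jetD(2)[OF D, of "[]" x] 0 jetD(1)[OF D] gradient_of_inner[OF G, of "[]"]
      by simp
    moreover from this have "R_nabla R (Suc 0) f x = G"
      using multilinD(2)[OF gradient_of_carr[OF G]] R_nabla_1[of R f x "G []"]
      by (auto simp: fun_eq_iff)
    ultimately show ?thesis using G by (auto simp del: R_nabla.simps)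
  qed
  then show ?case by blast
next
  case (Suc k)
  let ?F = "R_nabla R (Suc k) f"
  have G: "gradient_of k (D (Suc k) y) (?F y)" and d: "R_times_differentiable_at R (Suc k) f y" for y
    using Suc by auto
  have "R_times_differentiable_at R (Suc (Suc k)) f x \<and>
      gradient_of (Suc k) (D (Suc (Suc k)) x) (R_nabla R (Suc (Suc k)) f x)" for x
  proof -
    obtain G' where G': "gradient_of (Suc k) (D (Suc (Suc k)) x) G'"
      using gradient_of_exists[OF jetD(4)[OF D Suc.prems]] by blast
    have "has_R_higher_gradient_at R (Suc k) ?F x G'"
      using Suc.prems by (intro jet_has_R_higher_gradient[OF D _ G G']) simp
    note h = R_nabla_SucI[OF this gradient_of_carr[OF G]]
    show ?thesis using h(2) G' d unfolding h(1) R_times_differentiable_at.simps by blast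
  qed
  then show ?case by blast
qed

lemma jet_imp_BUC_R:
  assumes D: "jet n f D"
  shows "f \<in> BUC_R R n"
    and "Suc m \<le> n \<Longrightarrow> gradient_of m (D (Suc m) x) (R_nabla R (Suc m) f x)"
proof -
  show G: "gradient_of m (D (Suc m) x) (R_nabla R (Suc m) f x)" if "Suc m \<le> n" for m x
    using jet_R_nabla[OF D that] by blast
  have "R_nabla R i f \<in> BUC (multilin (i - 1) whole whole)" if i: "i \<in> {1..n}" for i
  proof -
    obtain m where m: "i = Suc m" "Suc m \<le> n" using i by (cases i) auto
    have "R_nabla R (Suc m) f \<in> BUC (multilin m whole whole)"
      by (subst BUC_gradient_of_iff[OF jetD(4)[OF D m(2)] G[OF m(2)]]) (rule jetD(3)[OF D m(2)])
    then show ?thesis by (simp add: m(1) del: R_nabla.simps)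
  qed
  moreover have "\<forall>x. R_times_differentiable_at R n f x"
    using jet_R_nabla[OF D] by (cases n) auto
  ultimately show "f \<in> BUC_R R n" using jet_0[OF D] by (simp add: BUC_R_def)
qed

section \<open>Comparison of the two gradients\<close>

lemma BUC_HR_eq_BUC_R: "BUC_HR R n = BUC_R R n"
  using jet_of_BUC_HR jet_imp_BUC_HR(1) jet_of_BUC_R jet_imp_BUC_R(1) by blast

text \<open>
  Moving along \<open>R w = 0\<close> does not move at all, so the form vanishes when its last argument is in
  the kernel.
\<close>

lemma R_nabla_ker_perp:
  assumes D: "jet n f D" and m: "Suc m \<le> n"
  shows "R_nabla R (Suc m) f x vs \<in> (ker R)\<^sup>\<bottom>"
proof (cases "length vs = m")
  case True
  note G = jet_imp_BUC_R(2)[OF D m, of x]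
  show ?thesis
    unfolding orthogonal_comp_def
  proof (intro CollectI ballI)
    fix w assume w: "w \<in> ker R"
    have "((\<lambda>s. D m (x + s *\<^sub>R R w) vs) has_real_derivative D (Suc m) x (vs @ [w])) (at 0)"
      using jetD(2)[OF D, of vs] True m by simp
    moreover have "((\<lambda>s. D m (x + s *\<^sub>R R w) vs) has_real_derivative 0) (at 0)"
      using w by (simp add: ker_def)
    ultimately have "D (Suc m) x (vs @ [w]) = 0" by (rule DERIV_unique)
    then show "orthogonal w (R_nabla R (Suc m) f x vs)"
      using gradient_of_inner[OF G True, of w] by (simp add: orthogonal_def inner_commute)
  qed
next
  case False
  then show ?thesis
    using multilinD(2)[OF gradient_of_carr[OF jet_imp_BUC_R(2)[OF D m, of x]]]
    by (simp add: subspace_0 subspace_orthogonal_comp)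
qed

text \<open>
  Restriction is the pullback along the inclusion of \<open>(ker R)\<^sup>\<bottom>\<close>, which is a contraction.
\<close>

lemma R_nabla_restrict_ker_perp:
  assumes D: "jet n f D" and m: "Suc m \<le> n"
  shows "restrict_tuples (ker_perp R) m (R_nabla R (Suc m) f x)
    \<in> carr (multilin m (ker_perp R) (ker_perp R))"
proof -
  let ?G = "R_nabla R (Suc m) f x"
  have "contraction (ker_perp R) whole (\<lambda>u. u)" by (simp add: contraction_def)
  from pullback_multilin(1)[OF normed_carrier_ker_perp normed_carrier_whole normed_carrier_whole this
      gradient_of_carr[OF jet_imp_BUC_R(2)[OF D m, of x]]]
  have T: "restrict_tuples (ker_perp R) m ?G \<in> carr (multilin m (ker_perp R) whole)"
    by (simp add: pullback_def del: R_nabla.simps)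
  show ?thesis
  proof (rule multilinI[OF normed_carrier_ker_perp normed_carrier_ker_perp multilinD(3)[OF T]])
    show "restrict_tuples (ker_perp R) m ?G hs \<in> carr (ker_perp R)" if "hs \<in> tuples (ker_perp R) m" for hs
      using R_nabla_ker_perp[OF D m] that by (simp add: restrict_tuples_def del: R_nabla.simps)
    show "nrm (ker_perp R) (restrict_tuples (ker_perp R) m ?G hs)
        \<le> nrm (multilin m (ker_perp R) whole) (restrict_tuples (ker_perp R) m ?G)
          * prod_list (map (nrm (ker_perp R)) hs)" if "hs \<in> tuples (ker_perp R) m" for hs
      using multilin_nrm_bound(2)[OF normed_carrier_ker_perp normed_carrier_whole T that]
      by (simp del: R_nabla.simps)
  qed (rule multilinD(2)[OF T])
qed

text \<open>
  Tested against \<open>h\<close> in \<open>H\<^sub>R\<close>, both sides are the form of the jet at the preimages.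
\<close>

lemma HR_nabla_eq_R_nabla:
  assumes D: "jet n f D" and m: "Suc m \<le> n" and vs: "vs \<in> tuples (HR R) m"
  shows "HR_nabla R (Suc m) f x vs = R (R_nabla R (Suc m) f x (map (pinv R) vs))"
proof (rule inner_HR_eqI)
  note G = jet_imp_BUC_R(2)[OF D m, of x] and G' = jet_imp_BUC_HR(2)[OF D m, of x]
  show "HR_nabla R (Suc m) f x vs \<in> range R" by (rule represents_range[OF G' vs])
  show "R (R_nabla R (Suc m) f x (map (pinv R) vs)) \<in> range R" by simp
  fix h assume h: "h \<in> range R"
  have len: "length (map (pinv R) vs) = m" using vs by (simp add: tuples_def)
  have "vs @ [h] \<in> tuples (HR R) (Suc m)" using vs h by (simp add: tuples_snoc)
  then have "inner_HR R (HR_nabla R (Suc m) f x vs) h = D (Suc m) x (map (pinv R) vs @ [pinv R h])"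
    using represents_inner[OF G' vs h] by (simp add: pullback_def restrict_tuples_def)
  also have "\<dots> = inner (R_nabla R (Suc m) f x (map (pinv R) vs)) (pinv R h)"
    using gradient_of_inner[OF G len] by simp
  also have "\<dots> = inner_HR R (R (R_nabla R (Suc m) f x (map (pinv R) vs))) h"
    unfolding inner_HR_def by (subst pinv_R[OF R_nabla_ker_perp[OF D m]]) (rule refl)
  finally show "inner_HR R (HR_nabla R (Suc m) f x vs) h
      = inner_HR R (R (R_nabla R (Suc m) f x (map (pinv R) vs))) h" .
qed

end

theorem theorem2p20:
  fixes R :: "'a::{real_inner, complete_space} \<Rightarrow> 'a" and n :: nat
  assumes "separable_space (euclidean :: 'a topology)"
    and "bounded_linear R"
    and "\<And>x y. inner (R x) y = inner x (R y)"
    and "n \<ge> 1"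
  shows "BUC_HR R n = BUC_R R n \<and>
    (\<forall>\<phi> \<in> BUC_R R n. \<forall>x.
       restrict_tuples (ker_perp R) (n - 1) (R_nabla R n \<phi> x)
         \<in> carr (multilin (n - 1) (ker_perp R) (ker_perp R)) \<and>
       HR_nabla R n \<phi> x
         = T_map R (n - 1) (restrict_tuples (ker_perp R) (n - 1) (R_nabla R n \<phi> x)) \<and>
       (n = 1 \<longrightarrow> HR_nabla R n \<phi> x [] = R (R_nabla R n \<phi> x [])) \<and>
       (n \<ge> 2 \<longrightarrow> (\<forall>vs \<in> tuples (HR R) (n - 1).
          HR_nabla R n \<phi> x vs = R (R_nabla R n \<phi> x (map (pinv R) vs)))))"
proof -
  interpret bounded_operator R unfolding bounded_operator_def by fact
  obtain m where n: "n = Suc m" using \<open>n \<ge> 1\<close> by (cases n) auto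
  have m: "n - 1 = m" "Suc m \<le> n" by (simp_all add: n)
  show ?thesis
  proof (intro conjI ballI allI impI)
    show "BUC_HR R n = BUC_R R n" by (rule BUC_HR_eq_BUC_R)
    fix \<phi> x assume "\<phi> \<in> BUC_R R n"
    then obtain D where D: "jet n \<phi> D" using jet_of_BUC_R by blast
    have eq: "HR_nabla R n \<phi> x vs = R (R_nabla R n \<phi> x (map (pinv R) vs))" if "vs \<in> tuples (HR R) m" for vs
      unfolding n by (rule HR_nabla_eq_R_nabla[OF D m(2) that])
    show "restrict_tuples (ker_perp R) (n - 1) (R_nabla R n \<phi> x)
        \<in> carr (multilin (n - 1) (ker_perp R) (ker_perp R))"
      unfolding m(1) using R_nabla_restrict_ker_perp[OF D m(2)] by (simp only: n)
    show "HR_nabla R n \<phi> x = T_map R (n - 1) (restrict_tuples (ker_perp R) (n - 1) (R_nabla R n \<phi> x))"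
      unfolding m(1)
    proof
      fix vs
      show "HR_nabla R n \<phi> x vs = T_map R m (restrict_tuples (ker_perp R) m (R_nabla R n \<phi> x)) vs"
      proof (cases "vs \<in> tuples (HR R) m")
        case True
        then show ?thesis
          using eq map_pinv_tuples by (simp add: T_map_def restrict_tuples_def)
      next
        case False
        then have "HR_nabla R (Suc m) \<phi> x vs = 0"
          by (rule multilinD(2)[OF represents_carr[OF jet_imp_BUC_HR(2)[OF D m(2)]]])
        then show ?thesis using False by (simp add: T_map_def restrict_tuples_def n del: R_nabla.simps)
      qed
    qed
    show "HR_nabla R n \<phi> x [] = R (R_nabla R n \<phi> x [])" if "n = 1"
      using eq[of "[]"] that by (simp add: n tuples_0)
    show "HR_nabla R n \<phi> x vs = R (R_nabla R n \<phi> x (map (pinv R) vs))" if "vs \<in> tuples (HR R) (n - 1)" for vs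
      using eq that by (simp only: m(1))
  qed
qed

end
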